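(* Assume the setting (H0) described in the context, and assume that $f$ admits (continuous) partial derivatives of any order with respect to $x$ and that they are bounded along $(X^s(\tau),\Lambda(\tau))$, $\tau\in\mathbb{R}$. Then the following hold. (i) There exist a sequence $(a^s_n)_{n\in\mathbb{N}}$ of bounded continuous functions from $\mathbb{R}$ into itself, with $a^s_0=X^s$, and sequences $(C^s_n)_{n\in\mathbb{N}}$ and $(\overline r^s_n)_{n\in\mathbb{N}}$ of positive real numbers, such that for every fixed $n\in\mathbb{N}$, if $0<r<\overline r^s_n$, \[ \Big\|\sum_{i=0}^n a_i^s(r\,\cdot\,)r^i -x^r_-(\cdot)\Big\|_{\mathcal{C}(\mathbb{R})}<C^s_n r^{n+1}, \] that is, the solution $x^r_-$ of $\dot x=f(x,\Lambda(rt))$ can be written as an asymptotic series; in particular \[ x^r_-(t)\sim X^s(rt)+\sum_{i=1}^\infty a_i^s(rt)r^i, \] where all the coefficients $a_i^s(\cdot)$ can be calculated using function values and derivatives of $f$ and $\Lambda$. Moreover, for any fixed $\varepsilon>0$, $n\in\mathbb{N}$ and $r>0$ there exists $\beta=\beta(\varepsilon,n,r)\in\mathbb{R}\cup\{\infty\}$ such that \[ \Big\|\sum_{i=0}^n a_i^s(r\,\cdot\,)r^i -x^r_-(\cdot)\Big\|_{\mathcal{C}((-\infty,\beta))}<\varepsilon . \] In particular, for all $n\in\mathbb{N}$, $\beta(\varepsilon,n,r)=\infty$ whenever $r<\min\big\{\overline r^s_n,\sqrt[n+1]{\varepsilon/C^s_n}\big\}$. (ii) If additionally (H1) holds and all the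 partial derivatives of $f$ with respect to $x$ are bounded along $(X^u(\tau),\Lambda(\tau))$, $\tau\in\mathbb{R}$, then an analogous result is valid for $x^r_+$: there are a sequence $(a^u_n)_{n\in\mathbb{N}}$ of bounded continuous functions from $\mathbb{R}$ into itself, with $a^u_0=X^u$, and sequences $(C^u_n)_{n\in\mathbb{N}}$ and $(\overline r^u_n)_{n\in\mathbb{N}}$ of positive real numbers such that for every fixed $n\in\mathbb{N}$, if $0<r<\overline r^u_n$, \[ \Big\|\sum_{i=0}^n a_i^u(r\,\cdot\,)r^i -x^r_+(\cdot)\Big\|_{\mathcal{C}(\mathbb{R})}<C^u_n r^{n+1}\quad\text{and}\quad x^r_+(t)\sim X^u(rt)+\sum_{i=1}^\infty a_i^u(rt)r^i, \] where all the coefficients $a_i^u(\cdot)$ can be calculated using function values and derivatives of $f$ and $\Lambda$. Moreover, for any fixed $\varepsilon>0$, $n\in\mathbb{N}$ and $r>0$ there exists $\alpha=\alpha(\varepsilon,n,r)\in\mathbb{R}\cup\{-\infty\}$ such that \[ \Big\|\sum_{i=0}^n a_i^u(r\,\cdot\,)r^i -x^r_+(\cdot)\Big\|_{\mathcal{C}((\alpha,\infty))}<\varepsilon . \] In particular, for all $n\in\mathbb{N}$, $\alpha(\varepsilon,n,r)=-\infty$ whenever $r<\min\big\{\overline r^u_n,\sqrt[n+1]{\varepsilon/C^u_n}\big\}$.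
   Context: Here $\mathbb{N}=\{0,1,2,\dots\}$ and $\|\cdot\|_{\mathcal{C}(I)}$ is the supremum norm on the interval $I$; an estimate in $\mathcal{C}(I)$ includes the assertion that the solution involved is defined on $I$. Setting (H0). Let $\lambda_-<\lambda_+$ be real numbers and let $f\in C^2(\mathbb{R}\times\mathbb{R},\mathbb{R})$, $(x,\lambda)\mapsto f(x,\lambda)$, be bounded and such that the autonomous scalar problems $\dot x=f(x,\lambda)$, $\lambda\in[\lambda_-,\lambda_+]$, have existence and uniqueness of solutions and continuous dependence on parameter and initial data. A fixed point $X$ of $\dot x=f(x,\lambda)$ is hyperbolic if $\partial_xf(X,\lambda)\ne0$; it is then stable if $\partial_xf(X,\lambda)<0$ and unstable if $\partial_xf(X,\lambda)>0$. For every $\lambda\in[\lambda_-,\lambda_+]$, except at most a finite number of points in $(\lambda_-,\lambda_+)$, $\dot x=f(x,\lambda)$ has only hyperbolic fixed points. There is a stable hyperbolic fixed point $X^s_-$ of $\dot x=f(x,\lambda_-)$ which is continuously perturbed into stable hyperbolic fixed points, i.e. there is a continuous function $X^s:[\lambda_-,\lambda_+]\to\mathbb{R}$ with $X^s(\lambda_-)=X^s_-$ such that $X^s(\lambda)$ is a stable hyperbolic fixed point of $\dot x=f(x,\lambda)$ for all $\lambda\in[\lambda_-,\lambda_+]$. Write $X^s_+:=X^s(\lambda_+)$. Let $\Lambda\in C^2(\mathbb{R},[\lambda_-,\lambda_+])$ be strictly increasing with $\lim_{t\to\pm\infty}\Lambda(t)=\lambda_\pm$ and $\lim_{t\to\pm\infty}\Lambda'(t)=0$.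 For $r>0$ consider \[ \dot x=f\big(x,\Lambda(rt)\big),\qquad x\in\mathbb{R},\ t\in\mathbb{R}. \qquad (E_r) \] With an abuse of notation $X^s(t):=X^s(\Lambda(t))$. There is $p>0$ such that $\partial_xf(X^s(t),\Lambda(t))<-p<0$ for all $t\in\mathbb{R}$. Assumption (H1). The problem $\dot x=f(x,\lambda_+)$ has an unstable hyperbolic fixed point $X^u_+$ which is continuously perturbed into a hyperbolic fixed point $X^u(\lambda)$ of $\dot x=f(x,\lambda)$ for all $\lambda\in[\lambda_-,\lambda_+]$ (so $X^u:[\lambda_-,\lambda_+]\to\mathbb{R}$ is continuous, $X^u(\lambda_+)=X^u_+$); write $X^u_-:=X^u(\lambda_-)$ and, again by abuse of notation, $X^u(t):=X^u(\Lambda(t))$. For all $\lambda\in[\lambda_-,\lambda_+]$ there are no further fixed points in the open interval with end-points $X^u(\lambda)$ and $X^s(\lambda)$. There is $d_0>0$ such that for any two distinct curves of quasi-static equilibria (continuous $X,Y:[\lambda_-,\lambda_+]\to\mathbb{R}$ of equilibria) one has $\min_{\lambda\in[\lambda_-,\lambda_+]}|X(\lambda)-Y(\lambda)|>d_0$. It is assumed that $X^s(\lambda)>X^u(\lambda)$ for all $\lambda$. Pullback solutions. For every $r>0$, $x^r_-:(-\infty,\beta^r_-)\to\mathbb{R}$ denotes the unique solution of $(E_r)$ with $\lim_{t\to-\infty}x^r_-(t)=X^s_-$, and (under (H1)) $x^r_+:(\beta^r_+,\infty)\to\mathbb{R}$ denotes the unique solution of $(E_r)$ with $\lim_{t\to\infty}x^r_+(t)=X^u_+$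 (both exist and are unique). Asymptotic series. For $I\subseteq\mathbb{R}$, $\varepsilon_0>0$ and $v:I\times[0,\varepsilon_0)\to\mathbb{R}$: if for all $n\in\mathbb{N}$ there are a continuous $\delta_n:\mathbb{R}^+\to\mathbb{R}^+$ vanishing at zero, a constant $C_n>0$ and a function $a_n:I\to\mathbb{R}$ with $\|v(t,\varepsilon)-\sum_{i=0}^n a_i(t)\delta_i(\varepsilon)\|_{\mathcal{C}(I,\mathbb{R})}<C_n\delta_n(\varepsilon)$, then $v(t,\varepsilon)\sim\sum_{i=0}^\infty a_i(t)\delta_i(\varepsilon)$ is called an asymptotic series of $v$. In the claim this is used with the small parameter $r$, gauge functions $r^i$ and coefficients $a_i(rt)$, and "$\sim$" expresses the estimates with bound $C_nr^{n+1}$ displayed in the claim. Coefficients. "Can be calculated using function values and derivatives of $f$ and $\Lambda$" refers to the coefficients obtained by inserting the formal series $\sum_i a_i(\tau)r^i$ in $r\,\frac{dx}{d\tau}=f(x,\Lambda(\tau))$ and comparing powers of $r$: with $a_0=X^s$ (resp. $a_0=X^u$), \[ a_1(\tau)=\big(\partial_xf\big)^{-1}\dot a_0(\tau),\qquad a_i(\tau)=\big(\partial_xf\big)^{-1}\Big[\dot a_{i-1}(\tau)-\sum_{j=2}^i\frac1{j!}\frac{\partial^jf}{\partial x^j}\sum_{\substack{k_1+\dots+k_j=i\\ k_l\ge1}}a_{k_1}(\tau)\cdots a_{k_j}(\tau)\Big]\quad(i\ge2), \] all derivatives of $f$ being evaluated at $(a_0(\tau),\Lambda(\tau))$.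
   Formalization: Added assumption: f has continuous mixed partial derivatives of all orders in (x,λ), and Λ is infinitely differentiable with every derivative bounded; with only C² regularity the coefficients need not exist or be bounded, and the estimates can fail. *)

theory Defs
  imports "HOL-Analysis.Analysis"
begin

section \<open>Regularity\<close>

definition d_x :: "(real \<Rightarrow> real \<Rightarrow> real) \<Rightarrow> real \<Rightarrow> real \<Rightarrow> real" where
  "d_x g x l = deriv (\<lambda>u. g u l) x"

definition d_l :: "(real \<Rightarrow> real \<Rightarrow> real) \<Rightarrow> real \<Rightarrow> real \<Rightarrow> real" where
  "d_l g x l = deriv (\<lambda>m. g x m) l"

fun Ck_line :: "nat \<Rightarrow> (real \<Rightarrow> real) \<Rightarrow> bool" where
  "Ck_line 0 g \<longleftrightarrow> continuous_on UNIV g"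
| "Ck_line (Suc k) g \<longleftrightarrow> (\<forall>t. g field_differentiable (at t)) \<and> Ck_line k (deriv g)"

fun Ck_plane :: "nat \<Rightarrow> (real \<Rightarrow> real \<Rightarrow> real) \<Rightarrow> bool" where
  "Ck_plane 0 g \<longleftrightarrow> continuous_on UNIV (\<lambda>(x, l). g x l)"
| "Ck_plane (Suc k) g \<longleftrightarrow>
     (\<forall>x l. (\<lambda>u. g u l) field_differentiable (at x) \<and> (\<lambda>m. g x m) field_differentiable (at l)) \<and>
     Ck_plane k (d_x g) \<and> Ck_plane k (d_l g)"

definition x_partials_continuous :: "(real \<Rightarrow> real \<Rightarrow> real) \<Rightarrow> bool" where
  "x_partials_continuous f \<longleftrightarrow>
     (\<forall>j. (\<forall>x l. (\<lambda>u. (d_x ^^ j) f u l) field_differentiable (at x)) \<and>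
          continuous_on UNIV (\<lambda>(x, l). (d_x ^^ j) f x l))"

definition x_partials_bounded_along ::
  "(real \<Rightarrow> real \<Rightarrow> real) \<Rightarrow> (real \<Rightarrow> real) \<Rightarrow> (real \<Rightarrow> real) \<Rightarrow> bool" where
  "x_partials_bounded_along f \<Lambda> X \<longleftrightarrow>
     (\<forall>j. bounded (range (\<lambda>\<tau>. (d_x ^^ j) f (X (\<Lambda> \<tau>)) (\<Lambda> \<tau>))))"

text \<open>
  The coefficient \<open>a\<^sub>i\<close> of the formal series contains \<open>\<Lambda>\<^sup>(\<^sup>i\<^sup>)\<close> and mixed partial derivatives of
  \<open>f\<close> up to order \<open>i\<close>, so the recursion below presupposes that these derivatives exist for every
  \<open>i\<close>, and boundedness of all \<open>a\<^sub>i\<close> presupposes bounded derivatives of \<open>\<Lambda>\<close>: for \<open>f\<close> equal to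
  \<open>\<lambda> - x\<close> near \<open>x = \<lambda>\<close> one has \<open>a\<^sub>i = (-1)\<^sup>i \<Lambda>\<^sup>(\<^sup>i\<^sup>)\<close>.  A function \<open>\<Lambda>\<close> of class \<open>C\<^sup>2\<close> whose first
  derivative vanishes at both ends need not have a third derivative or a bounded second one.
  Bounds on the mixed partial derivatives of \<open>f\<close> along the curves need no assumption, because
  the curves stay in compact sets.
\<close>

definition derivatives_of_all_orders ::
  "(real \<Rightarrow> real \<Rightarrow> real) \<Rightarrow> (real \<Rightarrow> real) \<Rightarrow> bool" where
  "derivatives_of_all_orders f \<Lambda> \<longleftrightarrow>
     (\<forall>k. Ck_plane k f) \<and> (\<forall>k. Ck_line k \<Lambda> \<and> bounded (range ((deriv ^^ k) \<Lambda>)))"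


section \<open>Equilibria\<close>

definition hyperbolic :: "(real \<Rightarrow> real \<Rightarrow> real) \<Rightarrow> real \<Rightarrow> real \<Rightarrow> bool" where
  "hyperbolic f l X \<longleftrightarrow> f X l = 0 \<and> d_x f X l \<noteq> 0"

definition stable_hyperbolic :: "(real \<Rightarrow> real \<Rightarrow> real) \<Rightarrow> real \<Rightarrow> real \<Rightarrow> bool" where
  "stable_hyperbolic f l X \<longleftrightarrow> f X l = 0 \<and> d_x f X l < 0"

definition unstable_hyperbolic :: "(real \<Rightarrow> real \<Rightarrow> real) \<Rightarrow> real \<Rightarrow> real \<Rightarrow> bool" where
  "unstable_hyperbolic f l X \<longleftrightarrow> f X l = 0 \<and> d_x f X l > 0"

definition equilibrium_curve ::
  "(real \<Rightarrow> real \<Rightarrow> real) \<Rightarrow> real \<Rightarrow> real \<Rightarrow> (real \<Rightarrow> real) \<Rightarrow> bool" where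
  "equilibrium_curve f lm lp X \<longleftrightarrow> continuous_on {lm..lp} X \<and> (\<forall>l\<in>{lm..lp}. f (X l) l = 0)"

text \<open>Since \<open>f\<close> is bounded, solutions are global; \<open>\<phi> t x0 l\<close> is the flow of \<open>x' = f x l\<close>.\<close>

definition well_posed :: "(real \<Rightarrow> real \<Rightarrow> real) \<Rightarrow> real \<Rightarrow> real \<Rightarrow> bool" where
  "well_posed f lm lp \<longleftrightarrow>
     (\<exists>\<phi> :: real \<Rightarrow> real \<Rightarrow> real \<Rightarrow> real.
        continuous_on (UNIV \<times> UNIV \<times> {lm..lp}) (\<lambda>(t, x0, l). \<phi> t x0 l) \<and>
        (\<forall>x0. \<forall>l\<in>{lm..lp}.
           \<phi> 0 x0 l = x0 \<and>
           (\<forall>t. ((\<lambda>s. \<phi> s x0 l) has_real_derivative f (\<phi> t x0 l) l) (at t)) \<and>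
           (\<forall>a b y. a < 0 \<and> 0 < b \<and> y 0 = x0 \<and>
              (\<forall>t\<in>{a<..<b}. (y has_real_derivative f (y t) l) (at t)) \<longrightarrow>
              (\<forall>t\<in>{a<..<b}. y t = \<phi> t x0 l))))"


section \<open>Standing assumptions\<close>

text \<open>
  The curve \<open>Xs\<close> is a function of the parameter in \<open>{lm..lp}\<close>; the function of time that
  carries the same name informally is \<open>\<lambda>t. Xs (\<Lambda> t)\<close>.
\<close>

definition H0 ::
  "(real \<Rightarrow> real \<Rightarrow> real) \<Rightarrow> (real \<Rightarrow> real) \<Rightarrow> real \<Rightarrow> real \<Rightarrow> (real \<Rightarrow> real) \<Rightarrow> real \<Rightarrow> bool" where
  "H0 f \<Lambda> lm lp Xs p \<longleftrightarrow>
     lm < lp \<and>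
     Ck_plane 2 f \<and> bounded (range (\<lambda>(x, l). f x l)) \<and> well_posed f lm lp \<and>
     (\<exists>F. finite F \<and> F \<subseteq> {lm<..<lp} \<and>
          (\<forall>l \<in> {lm..lp} - F. \<forall>x. f x l = 0 \<longrightarrow> hyperbolic f l x)) \<and>
     continuous_on {lm..lp} Xs \<and> (\<forall>l\<in>{lm..lp}. stable_hyperbolic f l (Xs l)) \<and>
     Ck_line 2 \<Lambda> \<and> range \<Lambda> \<subseteq> {lm..lp} \<and> strict_mono \<Lambda> \<and>
     (\<Lambda> \<longlongrightarrow> lm) at_bot \<and> (\<Lambda> \<longlongrightarrow> lp) at_top \<and>
     (deriv \<Lambda> \<longlongrightarrow> 0) at_bot \<and> (deriv \<Lambda> \<longlongrightarrow> 0) at_top \<and>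
     p > 0 \<and> (\<forall>t. d_x f (Xs (\<Lambda> t)) (\<Lambda> t) < - p)"

definition H1 ::
  "(real \<Rightarrow> real \<Rightarrow> real) \<Rightarrow> real \<Rightarrow> real \<Rightarrow> (real \<Rightarrow> real) \<Rightarrow> (real \<Rightarrow> real) \<Rightarrow> bool" where
  "H1 f lm lp Xs Xu \<longleftrightarrow>
     unstable_hyperbolic f lp (Xu lp) \<and>
     continuous_on {lm..lp} Xu \<and> (\<forall>l\<in>{lm..lp}. hyperbolic f l (Xu l)) \<and>
     (\<forall>l\<in>{lm..lp}. Xu l < Xs l) \<and>
     (\<forall>l\<in>{lm..lp}. \<forall>x\<in>{Xu l<..<Xs l}. f x l \<noteq> 0) \<and>
     (\<exists>d0>0. \<forall>X Y. equilibrium_curve f lm lp X \<and> equilibrium_curve f lm lp Y \<and>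
        (\<exists>l\<in>{lm..lp}. X l \<noteq> Y l) \<longrightarrow> (\<forall>l\<in>{lm..lp}. \<bar>X l - Y l\<bar> > d0))"


section \<open>Pullback solutions\<close>

definition solution_on ::
  "(real \<Rightarrow> real \<Rightarrow> real) \<Rightarrow> (real \<Rightarrow> real) \<Rightarrow> real \<Rightarrow> real set \<Rightarrow> (real \<Rightarrow> real) \<Rightarrow> bool" where
  "solution_on f \<Lambda> r S x \<longleftrightarrow> (\<forall>t\<in>S. (x has_real_derivative f (x t) (\<Lambda> (r * t))) (at t))"

text \<open>
  \<open>x\<close> restricted to \<open>(-\<infinity>, b)\<close> is the maximal solution with limit \<open>L\<close> at \<open>-\<infinity>\<close>, and it is unique:
  every other solution with this limit is a restriction of it.  Values of \<open>x\<close> outside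
  \<open>(-\<infinity>, b)\<close> are irrelevant.
\<close>

definition pullback_minus ::
  "(real \<Rightarrow> real \<Rightarrow> real) \<Rightarrow> (real \<Rightarrow> real) \<Rightarrow> real \<Rightarrow> real \<Rightarrow> ereal \<Rightarrow> (real \<Rightarrow> real) \<Rightarrow> bool" where
  "pullback_minus f \<Lambda> r L b x \<longleftrightarrow>
     b \<noteq> -\<infinity> \<and> solution_on f \<Lambda> r {t. ereal t < b} x \<and> (x \<longlongrightarrow> L) at_bot \<and>
     (\<forall>c y. c \<noteq> -\<infinity> \<and> solution_on f \<Lambda> r {t. ereal t < c} y \<and> (y \<longlongrightarrow> L) at_bot \<longrightarrow>
        c \<le> b \<and> (\<forall>t. ereal t < c \<longrightarrow> y t = x t))"

definition pullback_plus ::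
  "(real \<Rightarrow> real \<Rightarrow> real) \<Rightarrow> (real \<Rightarrow> real) \<Rightarrow> real \<Rightarrow> real \<Rightarrow> ereal \<Rightarrow> (real \<Rightarrow> real) \<Rightarrow> bool" where
  "pullback_plus f \<Lambda> r L b x \<longleftrightarrow>
     b \<noteq> \<infinity> \<and> solution_on f \<Lambda> r {t. b < ereal t} x \<and> (x \<longlongrightarrow> L) at_top \<and>
     (\<forall>c y. c \<noteq> \<infinity> \<and> solution_on f \<Lambda> r {t. c < ereal t} y \<and> (y \<longlongrightarrow> L) at_top \<longrightarrow>
        b \<le> c \<and> (\<forall>t. c < ereal t \<longrightarrow> y t = x t))"


section \<open>Asymptotic series\<close>

definition partial_sum :: "(nat \<Rightarrow> real \<Rightarrow> real) \<Rightarrow> nat \<Rightarrow> real \<Rightarrow> real \<Rightarrow> real" where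
  "partial_sum a n r t = (\<Sum>i\<le>n. a i (r * t) * r ^ i)"

text \<open>The supremum is taken in \<^typ>\<open>ereal\<close>, so that unbounded functions have norm \<open>\<infinity>\<close>.\<close>

definition sup_norm :: "real set \<Rightarrow> (real \<Rightarrow> real) \<Rightarrow> ereal" where
  "sup_norm I g = (SUP t\<in>I. ereal \<bar>g t\<bar>)"

text \<open>
  \<open>D\<close> is the domain of the solution \<open>x\<close>; the estimate includes that \<open>x\<close> is defined on \<open>I\<close>.
\<close>

definition estimate_on ::
  "real set \<Rightarrow> real set \<Rightarrow> (real \<Rightarrow> real) \<Rightarrow> (real \<Rightarrow> real) \<Rightarrow> real \<Rightarrow> bool" where
  "estimate_on I D s x K \<longleftrightarrow> I \<subseteq> D \<and> sup_norm I (\<lambda>t. s t - x t) < ereal K"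

text \<open>\<open>x r t \<sim> (\<Sum>i. a i (r t) r\<^sup>i)\<close> on all of \<open>\<real>\<close>, where \<open>D r\<close> is the domain of \<open>x r\<close>.\<close>

definition asymptotic_series ::
  "(real \<Rightarrow> real set) \<Rightarrow> (real \<Rightarrow> real \<Rightarrow> real) \<Rightarrow> (nat \<Rightarrow> real \<Rightarrow> real) \<Rightarrow> bool" where
  "asymptotic_series D x a \<longleftrightarrow>
     (\<forall>n. \<exists>C>0. \<exists>rbar>0. \<forall>r. 0 < r \<and> r < rbar \<longrightarrow>
        estimate_on UNIV (D r) (partial_sum a n r) (x r) (C * r ^ Suc n))"

definition compositions :: "nat \<Rightarrow> nat \<Rightarrow> nat list set" where
  "compositions j i = {ks. length ks = j \<and> sum_list ks = i \<and> (\<forall>k\<in>set ks. 1 \<le> k)}"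

text \<open>
  Comparison of the coefficients of \<open>r\<^sup>i\<close> in \<open>r dx/d\<tau> = f x (\<Lambda> \<tau>)\<close> with \<open>x = (\<Sum>i. a i \<tau> r\<^sup>i)\<close>.
  For \<open>i = 1\<close> the sum over \<open>j\<close> is empty.  Differentiability is required separately because
  \<^const>\<open>deriv\<close> is total.
\<close>

definition formal_coefficients ::
  "(real \<Rightarrow> real \<Rightarrow> real) \<Rightarrow> (real \<Rightarrow> real) \<Rightarrow> (nat \<Rightarrow> real \<Rightarrow> real) \<Rightarrow> bool" where
  "formal_coefficients f \<Lambda> a \<longleftrightarrow>
     (\<forall>i \<tau>. a i field_differentiable (at \<tau>)) \<and>
     (\<forall>i\<ge>1. \<forall>\<tau>.
        a i \<tau> = inverse (d_x f (a 0 \<tau>) (\<Lambda> \<tau>)) *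
          (deriv (a (i - 1)) \<tau> -
           (\<Sum>j=2..i. 1 / fact j * (d_x ^^ j) f (a 0 \<tau>) (\<Lambda> \<tau>) *
              (\<Sum>ks\<in>compositions j i. prod_list (map (\<lambda>k. a k \<tau>) ks)))))"

end

theory Submission
  imports Defs "HOL-Computational_Algebra.Formal_Power_Series"
begin

text \<open>
  Let \<open>x\<^sub>0 \<tau>\<close> be the quasi-static equilibrium \<open>X (\<Lambda> \<tau>)\<close> and let \<open>Y\<^sub>n \<tau> = (\<Sum>i\<le>n. a i \<tau> * r ^ i)\<close> be a
  truncation of the formal series.  Three facts give the estimates.

  First, the recursion for the coefficients is exactly what makes \<open>Y\<^sub>n\<close> solve the slow equation
  \<open>r dx/d\<tau> = f x (\<Lambda> \<tau>)\<close> up to an error \<open>O(r ^ (n + 1))\<close> that is uniform in \<open>\<tau>\<close> (\<open>residual_bound\<close>).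
  To see this, \<open>f\<close> is expanded in \<open>x\<close> about \<open>x\<^sub>0\<close> by Taylor's formula and the powers of
  \<open>Y\<^sub>n - x\<^sub>0\<close> are multiplied out as truncated power series in \<open>r\<close>; the coefficients of the \<open>j\<close>-th power of a
  power series are the sums over compositions into \<open>j\<close> parts.  All constants are uniform because
  \<open>x\<^sub>0\<close> and hence every coefficient is smooth with bounded derivatives: \<open>x\<^sub>0\<close> is differentiable by the
  implicit function theorem, and its derivative is again built from \<open>x\<^sub>0\<close>, \<open>\<Lambda>\<close> and partial
  derivatives of \<open>f\<close>.

  Second, every coefficient with \<open>i \<ge> 1\<close> vanishes at both ends of the time axis (\<open>coeff_tendsto_0\<close>).
  A convergent function whose second derivative is bounded has a derivative that tends to zero
  (\<open>deriv_tendsto_zero\<close>), and each term of the recursion contains such a derivative or a coefficient of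
  lower, positive index.  So a truncation and the pullback solution have the same limit at the end
  where the latter is anchored.  For every \<open>r\<close> this gives the \<open>\<epsilon>\<close>-approximation on some half-line.

  Third, in the stable case the difference \<open>w\<close> of a solution and a truncation satisfies
  \<open>w' = \<partial>\<^sub>xf(\<xi>) w + O(r ^ (n + 1))\<close> with \<open>\<partial>\<^sub>xf(\<xi>)\<close> negative and bounded away from zero while \<open>w\<close> is
  small.  At \<open>\<bar>w\<bar> = C r ^ (n + 1)\<close>, with \<open>C\<close> large, the derivative of \<open>w\<close> therefore points inwards, and a
  difference that vanishes at \<open>-\<infinity>\<close> never gets there (\<open>solution_tracks_truncation\<close>).  In the unstable
  case the same argument runs backwards in time; the sign \<open>\<sigma>\<close> in the lemmas below is the direction of
  time.

  The estimates hold on the whole line because a solution of an equation with bounded, locally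
  Lipschitz right-hand side continues past every finite time (\<open>solution_extends\<close>, by
  Picard's iteration), whereas a pullback solution is maximal by definition.
\<close>

unbundle no vec_syntax
unbundle fps_syntax

section \<open>Functions of the plane with continuous partial derivatives\<close>

text \<open>
  The two-sided form of the mean value theorem (\<open>a = b\<close> included), which makes it possible to pass to the limit \<open>b \<rightarrow> a\<close>
  along an arbitrary filter.
\<close>
lemma mean_value_near:
  fixes g :: "real \<Rightarrow> real"
  assumes "\<And>z. g field_differentiable (at z)"
  shows "\<exists>\<xi>. \<bar>\<xi> - a\<bar> \<le> \<bar>b - a\<bar> \<and> g b - g a = deriv g \<xi> * (b - a)"
proof -
  have D: "DERIV g z :> deriv g z" for z
    using assms by (simp add: field_differentiable_derivI)
  consider "a = b" | "a < b" | "b < a" by linarith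
  then show ?thesis
  proof cases
    case 1
    then show ?thesis by auto
  next
    case 2
    obtain z where "a < z" "z < b" "g b - g a = (b - a) * deriv g z"
      using MVT2[OF 2, of g "deriv g"] D by auto
    then show ?thesis by (intro exI[of _ z]) auto
  next
    case 3
    obtain z where "b < z" "z < a" "g a - g b = (a - b) * deriv g z"
      using MVT2[OF 3, of g "deriv g"] D by auto
    then show ?thesis by (intro exI[of _ z]) (auto simp: algebra_simps)
  qed
qed

lemma continuous_plane_tendsto:
  assumes "continuous_on UNIV (\<lambda>(x, l). G x l)" "(u \<longlongrightarrow> x) Fl" "(v \<longlongrightarrow> l) Fl"
  shows "((\<lambda>s. G (u s) (v s)) \<longlongrightarrow> (G x l :: real)) Fl"
  using continuous_on_tendsto_compose[OF assms(1) tendsto_Pair[OF assms(2,3)]] by simp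

text \<open>
  Changing one variable at a time reduces the increment of \<open>F\<close> to two applications of the mean value
  theorem; the intermediate points converge, so the slopes \<open>P\<close> and \<open>Q\<close> converge to the partial
  derivatives.  Continuity, the chain rule and implicit differentiation all follow
  from this one formula.
\<close>
lemma plane_increment:
  fixes u v :: "'a \<Rightarrow> real"
  assumes F: "Ck_plane (Suc 0) F" and u: "(u \<longlongrightarrow> x) Fl" and v: "(v \<longlongrightarrow> l) Fl"
  obtains P Q where "\<And>s. F (u s) (v s) - F x l = P s * (u s - x) + Q s * (v s - l)"
    and "(P \<longlongrightarrow> d_x F x l) Fl" and "(Q \<longlongrightarrow> d_l F x l) Fl"
proof -
  have "\<exists>\<xi>. \<bar>\<xi> - x\<bar> \<le> \<bar>u s - x\<bar> \<and> F (u s) (v s) - F x (v s) = d_x F \<xi> (v s) * (u s - x)" for s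
    using mean_value_near[of "\<lambda>z. F z (v s)" x "u s"] F by (auto simp: d_x_def)
  then obtain \<xi> where \<xi>: "\<And>s. \<bar>\<xi> s - x\<bar> \<le> \<bar>u s - x\<bar>"
      "\<And>s. F (u s) (v s) - F x (v s) = d_x F (\<xi> s) (v s) * (u s - x)"
    by metis
  have "\<exists>\<eta>. \<bar>\<eta> - l\<bar> \<le> \<bar>v s - l\<bar> \<and> F x (v s) - F x l = d_l F x \<eta> * (v s - l)" for s
    using mean_value_near[of "\<lambda>z. F x z" l "v s"] F by (auto simp: d_l_def)
  then obtain \<eta> where \<eta>: "\<And>s. \<bar>\<eta> s - l\<bar> \<le> \<bar>v s - l\<bar>"
      "\<And>s. F x (v s) - F x l = d_l F x (\<eta> s) * (v s - l)"
    by metis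
  have "((\<lambda>s. \<xi> s - x) \<longlongrightarrow> 0) Fl"
    by (rule Lim_null_comparison[of _ "\<lambda>s. \<bar>u s - x\<bar>"])
       (use \<xi>(1) u in \<open>auto simp: LIM_zero tendsto_rabs_zero\<close>)
  then have \<xi>': "(\<xi> \<longlongrightarrow> x) Fl" by (simp add: LIM_zero_iff)
  have "((\<lambda>s. \<eta> s - l) \<longlongrightarrow> 0) Fl"
    by (rule Lim_null_comparison[of _ "\<lambda>s. \<bar>v s - l\<bar>"])
       (use \<eta>(1) v in \<open>auto simp: LIM_zero tendsto_rabs_zero\<close>)
  then have \<eta>': "(\<eta> \<longlongrightarrow> l) Fl" by (simp add: LIM_zero_iff)
  have cx: "continuous_on UNIV (\<lambda>(x, l). d_x F x l)"
    and cl: "continuous_on UNIV (\<lambda>(x, l). d_l F x l)"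
    using F by simp_all
  show thesis
  proof (rule that)
    show "F (u s) (v s) - F x l = d_x F (\<xi> s) (v s) * (u s - x) + d_l F x (\<eta> s) * (v s - l)" for s
      by (simp flip: \<xi>(2) \<eta>(2))
    show "((\<lambda>s. d_x F (\<xi> s) (v s)) \<longlongrightarrow> d_x F x l) Fl"
      by (rule continuous_plane_tendsto[OF cx \<xi>' v])
    show "((\<lambda>s. d_l F x (\<eta> s)) \<longlongrightarrow> d_l F x l) Fl"
      by (rule continuous_plane_tendsto[OF cl tendsto_const \<eta>'])
  qed
qed

lemma Ck_plane_1_continuous:
  assumes "Ck_plane (Suc 0) F"
  shows "continuous_on UNIV (\<lambda>(x, l). F x l)"
proof -
  have "isCont (\<lambda>(x, l). F x l) (x, l)" for x l
  proof -
    let ?Fl = "at (x, l)"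
    have u: "(fst \<longlongrightarrow> x) ?Fl" and v: "(snd \<longlongrightarrow> l) ?Fl"
      using tendsto_fst[OF tendsto_ident_at, of "(x,l)" UNIV]
            tendsto_snd[OF tendsto_ident_at, of "(x,l)" UNIV] by simp_all
    obtain P Q where PQ: "\<And>s. F (fst s) (snd s) - F x l = P s * (fst s - x) + Q s * (snd s - l)"
      and P: "(P \<longlongrightarrow> d_x F x l) ?Fl" and Q: "(Q \<longlongrightarrow> d_l F x l) ?Fl"
      using plane_increment[OF assms u v] by blast
    have "((\<lambda>s. P s * (fst s - x) + Q s * (snd s - l)) \<longlongrightarrow>
        d_x F x l * (x - x) + d_l F x l * (l - l)) ?Fl"
      by (intro tendsto_intros P Q u v)
    then have "((\<lambda>s. F (fst s) (snd s) - F x l) \<longlongrightarrow> 0) ?Fl"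
      by (simp add: PQ)
    then show ?thesis
      by (simp add: isCont_def LIM_zero_iff case_prod_unfold)
  qed
  then show ?thesis
    by (auto intro!: continuous_at_imp_continuous_on)
qed

lemma Ck_plane_Suc_imp: "Ck_plane (Suc k) F \<Longrightarrow> Ck_plane k F"
proof (induction k arbitrary: F)
  case 0
  then show ?case unfolding Ck_plane.simps(1) by (rule Ck_plane_1_continuous)
next
  case (Suc k)
  have "Ck_plane k (d_x F)" "Ck_plane k (d_l F)"
    using Suc.prems Suc.IH[of "d_x F"] Suc.IH[of "d_l F"] by simp_all
  then show ?case using Suc.prems by (simp only: Ck_plane.simps) blast
qed

lemma Ck_plane_mono:
  assumes "k \<le> m" "Ck_plane m F"
  shows "Ck_plane k F"
  using assms
proof (induction rule: inc_induct)
  case (step n)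
  then show ?case using Ck_plane_Suc_imp by blast
qed

lemma Ck_plane_chain:
  assumes F: "Ck_plane (Suc 0) F" and u: "DERIV u t :> u'" and v: "DERIV v t :> v'"
  shows "DERIV (\<lambda>s. F (u s) (v s)) t :> d_x F (u t) (v t) * u' + d_l F (u t) (v t) * v'"
proof -
  have cu: "(u \<longlongrightarrow> u t) (at t)" and cv: "(v \<longlongrightarrow> v t) (at t)"
    using u v DERIV_isCont isCont_def by blast+
  obtain P Q where PQ: "\<And>s. F (u s) (v s) - F (u t) (v t) = P s * (u s - u t) + Q s * (v s - v t)"
    and P: "(P \<longlongrightarrow> d_x F (u t) (v t)) (at t)" and Q: "(Q \<longlongrightarrow> d_l F (u t) (v t)) (at t)"
    using plane_increment[OF F cu cv] by blast
  have "((\<lambda>s. P s * ((u s - u t) / (s - t)) + Q s * ((v s - v t) / (s - t))) \<longlongrightarrow>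
      d_x F (u t) (v t) * u' + d_l F (u t) (v t) * v') (at t)"
    using u v by (intro tendsto_intros P Q) (auto simp: has_field_derivative_iff)
  then show ?thesis
    by (simp add: has_field_derivative_iff PQ add_divide_distrib)
qed

text \<open>
  Along a zero curve the left-hand side of \<open>plane_increment\<close> vanishes, and the formula can be solved for
  the difference quotient of \<open>u\<close>.
\<close>
lemma implicit_curve_DERIV:
  assumes F: "Ck_plane (Suc 0) F" and zero: "\<And>s. F (u s) (v s) = 0"
    and u: "isCont u t" and v: "DERIV v t :> v'" and nz: "d_x F (u t) (v t) \<noteq> 0"
  shows "DERIV u t :> - (d_l F (u t) (v t) * v') * inverse (d_x F (u t) (v t))"
proof -
  have cu: "(u \<longlongrightarrow> u t) (at t)" and cv: "(v \<longlongrightarrow> v t) (at t)"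
    using u v DERIV_isCont isCont_def by blast+
  obtain P Q where PQ: "\<And>s. F (u s) (v s) - F (u t) (v t) = P s * (u s - u t) + Q s * (v s - v t)"
    and P: "(P \<longlongrightarrow> d_x F (u t) (v t)) (at t)" and Q: "(Q \<longlongrightarrow> d_l F (u t) (v t)) (at t)"
    using plane_increment[OF F cu cv] by blast
  have lim: "((\<lambda>s. - (Q s * ((v s - v t) / (s - t))) * inverse (P s)) \<longlongrightarrow>
      - (d_l F (u t) (v t) * v') * inverse (d_x F (u t) (v t))) (at t)"
    using v nz by (intro tendsto_intros P Q) (auto simp: has_field_derivative_iff)
  have "eventually (\<lambda>s. P s \<noteq> 0) (at t)"
    using tendsto_imp_eventually_ne[OF P nz] .
  then have "eventually (\<lambda>s. - (Q s * ((v s - v t) / (s - t))) * inverse (P s) = (u s - u t) / (s - t)) (at t)"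
  proof eventually_elim
    case (elim s)
    have "u s - u t = - (Q s * (v s - v t)) / P s"
      using PQ[of s] zero elim by (simp add: field_simps)
    then have "(u s - u t) / (s - t) = (- (Q s * (v s - v t)) / P s) / (s - t)"
      by simp
    also have "\<dots> = - (Q s * ((v s - v t) / (s - t))) * inverse (P s)"
      by (simp add: divide_inverse mult.assoc mult.commute mult.left_commute)
    finally show ?case by simp
  qed
  then show ?thesis
    using Lim_transform_eventually[OF lim] by (simp add: has_field_derivative_iff)
qed

section \<open>Functions with bounded derivatives\<close>

fun Ck_bounded :: "nat \<Rightarrow> (real \<Rightarrow> real) \<Rightarrow> bool" where
  "Ck_bounded 0 h \<longleftrightarrow> continuous_on UNIV h \<and> bounded (range h)"
| "Ck_bounded (Suc k) h \<longleftrightarrow> (\<forall>t. h field_differentiable (at t)) \<and> bounded (range h) \<and> Ck_bounded k (deriv h)"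

lemma Ck_bounded_imp_bounded: "Ck_bounded k h \<Longrightarrow> bounded (range h)"
  by (cases k) auto

lemma Ck_bounded_Suc_imp: "Ck_bounded (Suc k) h \<Longrightarrow> Ck_bounded k h"
proof (induction k arbitrary: h)
  case 0
  then show ?case
    by (auto intro!: continuous_at_imp_continuous_on field_differentiable_imp_continuous_at)
next
  case (Suc k)
  then show ?case by (metis Ck_bounded.simps(2))
qed

lemma Ck_bounded_continuous: "Ck_bounded k h \<Longrightarrow> continuous_on UNIV h"
proof (induction k)
  case (Suc k)
  then show ?case using Ck_bounded_Suc_imp by blast
qed simp

lemma Ck_bounded_SucI:
  assumes "\<And>t. DERIV h t :> h' t" "bounded (range h)" "Ck_bounded k h'"
  shows "Ck_bounded (Suc k) h"
proof -
  have "deriv h = h'" using assms(1) DERIV_imp_deriv by blast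
  then show ?thesis using assms by (auto simp: field_differentiable_def)
qed

lemma Ck_bounded_DERIV: "Ck_bounded (Suc k) h \<Longrightarrow> DERIV h t :> deriv h t"
  by (simp add: field_differentiable_derivI)

lemma Ck_bounded_const [simp]: "Ck_bounded k (\<lambda>_. c)"
proof (induction k arbitrary: c)
  case 0 then show ?case by auto
next
  case (Suc k) 
  show ?case by (rule Ck_bounded_SucI[where h'="\<lambda>_. 0"]) (use Suc in auto)
qed

lemma Ck_bounded_add: "Ck_bounded k g \<Longrightarrow> Ck_bounded k h \<Longrightarrow> Ck_bounded k (\<lambda>t. g t + h t)"
proof (induction k arbitrary: g h)
  case 0
  then show ?case by (auto intro!: continuous_intros bounded_plus_comp)
next
  case (Suc k)
  show ?case
  proof (rule Ck_bounded_SucI[where h'="\<lambda>t. deriv g t + deriv h t"])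
    show "DERIV (\<lambda>t. g t + h t) t :> deriv g t + deriv h t" for t
      using Suc.prems Ck_bounded_DERIV by (intro DERIV_add) blast+
  qed (use Suc in \<open>auto intro: bounded_plus_comp\<close>)
qed

lemma bounded_mult_comp:
  fixes g h :: "real \<Rightarrow> real"
  assumes "bounded (range g)" "bounded (range h)"
  shows "bounded (range (\<lambda>t. g t * h t))"
proof -
  obtain A B where "\<And>t. \<bar>g t\<bar> \<le> A" "\<And>t. \<bar>h t\<bar> \<le> B"
    using assms by (auto simp: bounded_iff)
  then have "\<bar>g t * h t\<bar> \<le> A * B" for t
    by (simp add: abs_mult mult_mono')
  then show ?thesis by (auto simp: bounded_iff)
qed

lemma Ck_bounded_mult: "Ck_bounded k g \<Longrightarrow> Ck_bounded k h \<Longrightarrow> Ck_bounded k (\<lambda>t. g t * h t)"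
proof (induction k arbitrary: g h)
  case 0
  then show ?case by (auto intro!: continuous_intros bounded_mult_comp)
next
  case (Suc k)
  have gh: "Ck_bounded k g" "Ck_bounded k h" using Suc.prems Ck_bounded_Suc_imp by blast+
  show ?case
  proof (rule Ck_bounded_SucI[where h'="\<lambda>t. deriv g t * h t + deriv h t * g t"])
    show "DERIV (\<lambda>t. g t * h t) t :> deriv g t * h t + deriv h t * g t" for t
      using Suc.prems Ck_bounded_DERIV by (intro DERIV_mult) blast+
    show "Ck_bounded k (\<lambda>t. deriv g t * h t + deriv h t * g t)"
      using Suc gh by (intro Ck_bounded_add Suc.IH) auto
  qed (use Suc.prems in \<open>auto intro: bounded_mult_comp\<close>)
qed

lemma Ck_bounded_minus: "Ck_bounded k g \<Longrightarrow> Ck_bounded k (\<lambda>t. - g t)"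
  using Ck_bounded_mult[of k "\<lambda>_. - 1" g] by simp

lemma Ck_bounded_diff: "Ck_bounded k g \<Longrightarrow> Ck_bounded k h \<Longrightarrow> Ck_bounded k (\<lambda>t. g t - h t)"
  using Ck_bounded_add[of k g "\<lambda>t. - h t"] Ck_bounded_minus[of k h] by simp

lemma Ck_bounded_sum: "(\<And>i. i \<in> I \<Longrightarrow> Ck_bounded k (g i)) \<Longrightarrow> Ck_bounded k (\<lambda>t. \<Sum>i\<in>I. g i t)"
  by (induction I rule: infinite_finite_induct) (auto intro!: Ck_bounded_add)

lemma Ck_bounded_prod_list: "(\<And>i. i \<in> set is \<Longrightarrow> Ck_bounded k (g i)) \<Longrightarrow> Ck_bounded k (\<lambda>t. prod_list (map (\<lambda>i. g i t) is))"
  by (induction "is") (auto intro!: Ck_bounded_mult)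

lemma Ck_bounded_inverse:
  assumes "m > 0" "\<And>t. \<bar>g t\<bar> \<ge> m" "Ck_bounded k g"
  shows "Ck_bounded k (\<lambda>t. inverse (g t))"
  using assms(3)
proof (induction k)
  case 0
  have nz: "g t \<noteq> 0" for t using assms(1) assms(2)[of t] by auto
  have "\<bar>inverse (g t)\<bar> \<le> inverse m" for t
    using assms(1) assms(2)[of t] by (simp add: le_imp_inverse_le)
  then have "bounded (range (\<lambda>t. inverse (g t)))" by (auto simp: bounded_iff)
  then show ?case using 0 nz by (auto intro!: continuous_intros)
next
  case (Suc k)
  have nz: "g t \<noteq> 0" for t using assms(1) assms(2)[of t] by auto
  have IH: "Ck_bounded k (\<lambda>t. inverse (g t))" using Suc Ck_bounded_Suc_imp by blast
  show ?case
  proof (rule Ck_bounded_SucI[where h'="\<lambda>t. - (inverse (g t) * deriv g t * inverse (g t))"])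
    show "DERIV (\<lambda>t. inverse (g t)) t :> - (inverse (g t) * deriv g t * inverse (g t))" for t
      using nz Ck_bounded_DERIV[OF Suc.prems] by (intro DERIV_inverse') auto
    show "Ck_bounded k (\<lambda>t. - (inverse (g t) * deriv g t * inverse (g t)))"
      using Suc.prems by (intro Ck_bounded_minus Ck_bounded_mult IH) auto
  qed (use Ck_bounded_imp_bounded[OF IH] in auto)
qed

text \<open>
  Bounded arguments stay in a rectangle, on which \<open>F\<close> is bounded by compactness.
\<close>
lemma bounded_range_compose:
  assumes cont: "continuous_on UNIV (\<lambda>(x, l). F x l :: real)"
    and uv: "bounded (range (u :: real \<Rightarrow> real))" "bounded (range (v :: real \<Rightarrow> real))"
  shows "bounded (range (\<lambda>t. F (u t) (v t)))"
proof -
  obtain A B where AB: "\<And>t. \<bar>u t\<bar> \<le> A" "\<And>t. \<bar>v t\<bar> \<le> B"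
    using uv by (auto simp: bounded_iff)
  have "compact ((\<lambda>(x, l). F x l) ` ({-A..A} \<times> {-B..B}))"
    by (intro compact_continuous_image compact_Times)
       (auto intro: continuous_on_subset[OF cont])
  then have "bounded ((\<lambda>(x, l). F x l) ` ({-A..A} \<times> {-B..B}))"
    by (rule compact_imp_bounded)
  moreover have "range (\<lambda>t. F (u t) (v t)) \<subseteq> (\<lambda>(x, l). F x l) ` ({-A..A} \<times> {-B..B})"
  proof
    fix y assume "y \<in> range (\<lambda>t. F (u t) (v t))"
    then obtain t where "y = F (u t) (v t)" by blast
    moreover have "(u t, v t) \<in> {-A..A} \<times> {-B..B}"
      using AB(1)[of t] AB(2)[of t] by auto
    ultimately show "y \<in> (\<lambda>(x, l). F x l) ` ({-A..A} \<times> {-B..B})"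
      by (metis (mono_tags, lifting) case_prod_conv image_eqI)
  qed
  ultimately show ?thesis using bounded_subset by blast
qed

text \<open>
  The chain rule reduces a derivative of the composition to partial derivatives of \<open>F\<close>, which are bounded along
  \<open>(u, v)\<close> because the pair stays in a compact rectangle.
\<close>
lemma Ck_bounded_compose:
  assumes "Ck_plane k F" "Ck_bounded k u" "Ck_bounded k v"
  shows "Ck_bounded k (\<lambda>t. F (u t) (v t))"
  using assms
proof (induction k arbitrary: F)
  case 0
  have "continuous_on UNIV (\<lambda>t. F (u t) (v t))"
    using 0 continuous_on_compose2[of UNIV "\<lambda>(x, l). F x l" UNIV "\<lambda>t. (u t, v t)"]
    by (auto intro: continuous_on_Pair)
  then show ?case using bounded_range_compose[of F u v] 0 by auto
next
  case (Suc k)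
  note F = Suc.prems(1) and u = Suc.prems(2) and v = Suc.prems(3)
  have uv: "Ck_bounded k u" "Ck_bounded k v" using Ck_bounded_Suc_imp[OF u] Ck_bounded_Suc_imp[OF v] .
  have F1: "Ck_plane (Suc 0) F" using F by (rule Ck_plane_mono[rotated]) simp
  have Fx: "Ck_plane k (d_x F)" and Fl: "Ck_plane k (d_l F)" using F by simp_all
  have D: "DERIV (\<lambda>t. F (u t) (v t)) t :> d_x F (u t) (v t) * deriv u t + d_l F (u t) (v t) * deriv v t" for t
    by (rule Ck_plane_chain[OF F1 Ck_bounded_DERIV[OF u] Ck_bounded_DERIV[OF v]])
  have "Ck_bounded k (deriv u)" "Ck_bounded k (deriv v)" using u v by simp_all
  then have C: "Ck_bounded k (\<lambda>t. d_x F (u t) (v t) * deriv u t + d_l F (u t) (v t) * deriv v t)"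
    using Suc.IH[OF Fx uv] Suc.IH[OF Fl uv] by (intro Ck_bounded_add Ck_bounded_mult)
  show ?case
    by (rule Ck_bounded_SucI[OF D bounded_range_compose[OF Ck_plane_1_continuous[OF F1] Ck_bounded_imp_bounded[OF u] Ck_bounded_imp_bounded[OF v]] C])
qed

text \<open>
  Barbalat's argument: by the mean value theorem \<open>deriv h t\<close> differs from the difference quotient over
  \<open>[t, t + \<delta>]\<close>, which tends to zero, by at most \<open>M * \<delta>\<close>, where \<open>M\<close> bounds the second derivative.  The
  hypothesis on \<open>Fl\<close> covers both ends of the real line.
\<close>
lemma deriv_tendsto_zero:
  assumes h: "Ck_bounded (Suc (Suc k)) h" and lim: "(h \<longlongrightarrow> L) Fl"
    and shift: "\<And>\<delta>::real. filterlim (\<lambda>t. t + \<delta>) Fl Fl"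
  shows "(deriv h \<longlongrightarrow> 0) Fl"
proof (rule tendstoI)
  fix e :: real assume e: "e > 0"
  obtain M where M: "\<And>t. \<bar>deriv (deriv h) t\<bar> \<le> M" "M > 0"
  proof -
    have "bounded (range (deriv (deriv h)))" using h Ck_bounded_imp_bounded[of k "deriv (deriv h)"] by simp
    then show thesis using that by (auto simp: bounded_pos)
  qed
  \<comment> \<open>With this \<open>\<delta>\<close> the error term \<open>M * \<delta>\<close> is half the tolerance.\<close>
  define \<delta> where "\<delta> = e / (2 * M)"
  have \<delta>: "\<delta> > 0" using e M by (simp add: \<delta>_def)
  have est: "\<bar>deriv h t\<bar> \<le> \<bar>h (t + \<delta>) - h t\<bar> / \<delta> + e / 2" for t
  proof -
    obtain \<xi> where \<xi>: "\<bar>\<xi> - t\<bar> \<le> \<bar>t + \<delta> - t\<bar>" "h (t + \<delta>) - h t = deriv h \<xi> * (t + \<delta> - t)"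
      using mean_value_near[of h t "t + \<delta>"] h by auto
    obtain \<zeta> where \<zeta>: "deriv h t - deriv h \<xi> = deriv (deriv h) \<zeta> * (t - \<xi>)"
      using mean_value_near[of "deriv h" \<xi> t] h by auto
    have "\<bar>deriv h t - deriv h \<xi>\<bar> \<le> M * \<delta>"
      unfolding \<zeta> abs_mult using M \<xi>(1) \<delta> by (intro mult_mono) auto
    also have "M * \<delta> = e / 2" using M by (simp add: \<delta>_def)
    finally have "\<bar>deriv h t\<bar> \<le> \<bar>deriv h \<xi>\<bar> + e / 2" by linarith
    also have "\<bar>deriv h \<xi>\<bar> = \<bar>h (t + \<delta>) - h t\<bar> / \<delta>"
      using \<xi>(2) \<delta> by (simp add: abs_mult)
    finally show ?thesis .
  qed
  have "((\<lambda>t. \<bar>h (t + \<delta>) - h t\<bar> / \<delta>) \<longlongrightarrow> \<bar>L - L\<bar> / \<delta>) Fl"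
    by (intro tendsto_intros lim filterlim_compose[OF lim shift]) (use \<delta> in auto)
  then have "eventually (\<lambda>t. \<bar>h (t + \<delta>) - h t\<bar> / \<delta> < e / 2) Fl"
    using e by (intro order_tendstoD(2)) auto
  then show "eventually (\<lambda>t. dist (deriv h t) 0 < e) Fl"
  proof eventually_elim
    case (elim t)
    then show ?case using est[of t] unfolding dist_real_def diff_0_right by linarith
  qed
qed

lemma Ck_bounded_of_bounded_derivatives:
  assumes "\<And>k. Ck_line k h" "\<And>k. bounded (range ((deriv ^^ k) h))"
  shows "Ck_bounded k h"
  using assms
proof (induction k arbitrary: h)
  case 0
  have "Ck_line 0 h" "bounded (range ((deriv ^^ 0) h))" by (rule 0)+
  then show ?case by simp
next
  case (Suc k)
  have "Ck_line k (deriv h)" for k using Suc.prems(1)[of "Suc k"] by simp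
  moreover have "bounded (range ((deriv ^^ k) (deriv h)))" for k
    using Suc.prems(2)[of "Suc k"] by (simp add: funpow_swap1)
  ultimately have "Ck_bounded k (deriv h)" by (rule Suc.IH)
  moreover have "\<forall>t. h field_differentiable (at t)" using Suc.prems(1)[of "Suc 0"] by simp
  moreover have "bounded (range h)" using Suc.prems(2)[of 0] by simp
  ultimately show ?case by simp
qed

section \<open>The coefficients of the formal series\<close>

text \<open>
  A part of a composition of \<open>i\<close> into \<open>j\<close> parts leaves at least \<open>j - 1\<close> for the others.  In particular the
  parts are smaller than \<open>i\<close> when \<open>j \<ge> 2\<close>, so that the recursion for the coefficients is well founded.
\<close>
lemma compositions_part:
  assumes "ks \<in> compositions j i" "k \<in> set ks"
  shows "1 \<le> k" "k + j \<le> Suc i"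
proof -
  show "1 \<le> k" using assms by (auto simp: compositions_def)
  obtain xs ys where ks: "ks = xs @ k # ys" using assms(2) by (meson split_list)
  have len: "length zs \<le> sum_list zs" if "\<forall>z\<in>set zs. 1 \<le> z" for zs :: "nat list"
    using that by (induction zs) auto
  have "length xs \<le> sum_list xs" "length ys \<le> sum_list ys"
    using assms(1) ks by (auto intro!: len simp: compositions_def)
  then show "k + j \<le> Suc i" using assms(1) ks by (auto simp: compositions_def)
qed

lemma compositions_empty: "i < j \<Longrightarrow> compositions j i = {}"
proof (rule ccontr)
  assume "i < j" "compositions j i \<noteq> {}"
  then obtain ks where ks: "ks \<in> compositions j i" by blast
  then have "ks \<noteq> []" using \<open>i < j\<close> by (auto simp: compositions_def)
  then obtain k where k: "k \<in> set ks" by (meson hd_in_set)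
  show False using compositions_part[OF ks k] \<open>i < j\<close> by linarith
qed

lemma tendsto_prod_list:
  fixes g :: "'i \<Rightarrow> 'a \<Rightarrow> real"
  shows "(\<And>i. i \<in> set is \<Longrightarrow> (g i \<longlongrightarrow> c i) Fl) \<Longrightarrow>
   ((\<lambda>t. prod_list (map (\<lambda>i. g i t) is)) \<longlongrightarrow> prod_list (map c is)) Fl"
  by (induction "is") (auto intro!: tendsto_mult)

text \<open>
  The test \<open>k \<le> n\<close> only makes termination visible; it always succeeds for the
  compositions in question (see \<open>coeff_recursion\<close>).
\<close>
fun slow_coeff ::
  "(real \<Rightarrow> real \<Rightarrow> real) \<Rightarrow> (real \<Rightarrow> real) \<Rightarrow> (real \<Rightarrow> real) \<Rightarrow> nat \<Rightarrow> real \<Rightarrow> real" where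
  "slow_coeff f \<Lambda> x 0 = x"
| "slow_coeff f \<Lambda> x (Suc n) = (\<lambda>\<tau>. inverse (d_x f (x \<tau>) (\<Lambda> \<tau>)) *
     (deriv (slow_coeff f \<Lambda> x n) \<tau> -
      (\<Sum>j=2..Suc n. 1 / fact j * (d_x ^^ j) f (x \<tau>) (\<Lambda> \<tau>) *
         (\<Sum>ks\<in>compositions j (Suc n).
            prod_list (map (\<lambda>k. if k \<le> n then slow_coeff f \<Lambda> x k \<tau> else 0) ks)))))"

declare slow_coeff.simps(2) [simp del]

lemma Ck_plane_d_x_iterate:
  assumes "\<And>k. Ck_plane k f"
  shows "Ck_plane k ((d_x ^^ j) f)"
proof (induction j arbitrary: k)
  case 0
  show ?case using assms by simp
next
  case (Suc j)
  have "Ck_plane (Suc k) ((d_x ^^ j) f)" by (rule Suc.IH)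
  then show ?case by simp
qed

text \<open>
  A curve of hyperbolic zeros of \<open>f\<close>, parametrised by the slow time: \<open>x\<^sub>0 \<tau>\<close> stands for the equilibrium at parameter
  value \<open>\<Lambda> \<tau>\<close>.  The sign of the linearisation is left open, so that stable and unstable curves are
  treated together.
\<close>
locale slow_curve =
  fixes f :: "real \<Rightarrow> real \<Rightarrow> real" and \<Lambda> x\<^sub>0 :: "real \<Rightarrow> real" and m :: real
  assumes f_smooth: "\<And>k. Ck_plane k f"
    and \<Lambda>_smooth: "\<And>k. Ck_bounded k \<Lambda>"
    and curve_continuous: "continuous_on UNIV x\<^sub>0"
    and curve_bounded: "bounded (range x\<^sub>0)"
    and on_curve: "\<And>\<tau>. f (x\<^sub>0 \<tau>) (\<Lambda> \<tau>) = 0"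
    and m_pos: "m > 0"
    and normally_hyperbolic: "\<And>\<tau>. m \<le> \<bar>d_x f (x\<^sub>0 \<tau>) (\<Lambda> \<tau>)\<bar>"
begin

abbreviation a :: "nat \<Rightarrow> real \<Rightarrow> real" where
  "a \<equiv> slow_coeff f \<Lambda> x\<^sub>0"

lemma fx_nonzero: "d_x f (x\<^sub>0 \<tau>) (\<Lambda> \<tau>) \<noteq> 0"
  using normally_hyperbolic[of \<tau>] m_pos by auto

text \<open>
  A bootstrap: implicit differentiation expresses the derivative of \<open>x\<^sub>0\<close> by \<open>x\<^sub>0\<close> itself, so each degree of
  regularity yields the next.  The bounds come along because \<open>\<partial>\<^sub>xf\<close> stays away from zero on the curve.
\<close>
lemma curve_smooth: "Ck_bounded k x\<^sub>0"
proof (induction k)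
  case 0
  show ?case using curve_continuous curve_bounded by simp
next
  case (Suc k)
  have fx: "Ck_plane k (d_x f)" and fl: "Ck_plane k (d_l f)"
    using f_smooth[of "Suc k"] by simp_all
  have dL: "Ck_bounded k (deriv \<Lambda>)" using \<Lambda>_smooth[of "Suc k"] by simp
  show ?case
  proof (rule Ck_bounded_SucI)
    show "DERIV x\<^sub>0 t :> - (d_l f (x\<^sub>0 t) (\<Lambda> t) * deriv \<Lambda> t) * inverse (d_x f (x\<^sub>0 t) (\<Lambda> t))" for t
      using curve_continuous
      by (intro implicit_curve_DERIV f_smooth on_curve fx_nonzero Ck_bounded_DERIV[OF \<Lambda>_smooth])
         (simp add: continuous_on_eq_continuous_at)
    show "bounded (range x\<^sub>0)" by (rule curve_bounded)
    show "Ck_bounded k (\<lambda>t. - (d_l f (x\<^sub>0 t) (\<Lambda> t) * deriv \<Lambda> t) * inverse (d_x f (x\<^sub>0 t) (\<Lambda> t)))"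
      by (intro Ck_bounded_mult Ck_bounded_minus Ck_bounded_inverse[OF m_pos normally_hyperbolic] dL
          Ck_bounded_compose[OF fx Suc.IH \<Lambda>_smooth] Ck_bounded_compose[OF fl Suc.IH \<Lambda>_smooth])
  qed
qed

lemma partial_smooth: "Ck_bounded k (\<lambda>\<tau>. (d_x ^^ j) f (x\<^sub>0 \<tau>) (\<Lambda> \<tau>))"
  by (rule Ck_bounded_compose[OF Ck_plane_d_x_iterate[OF f_smooth] curve_smooth \<Lambda>_smooth])

lemma coeff_smooth: "Ck_bounded k (a n)"
proof (induction n arbitrary: k rule: less_induct)
  case (less n)
  show ?case
  proof (cases n)
    case 0
    then show ?thesis using curve_smooth by simp
  next
    case (Suc n')
    have d: "Ck_bounded k (deriv (a n'))" using less[of n' "Suc k"] Suc by simp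
    have g: "Ck_bounded k (\<lambda>\<tau>. if i \<le> n' then a i \<tau> else 0)" for i
      using less[of i k] Suc by (cases "i \<le> n'") auto
    have fx: "Ck_bounded k (\<lambda>\<tau>. d_x f (x\<^sub>0 \<tau>) (\<Lambda> \<tau>))" using partial_smooth[of k 1] by simp
    show ?thesis
      unfolding Suc slow_coeff.simps(2)
      by (intro Ck_bounded_mult[OF Ck_bounded_inverse[OF m_pos normally_hyperbolic fx]]
          Ck_bounded_diff[OF d] Ck_bounded_sum Ck_bounded_mult[OF Ck_bounded_mult[OF Ck_bounded_const partial_smooth]] Ck_bounded_prod_list g)
  qed
qed

lemma coeff_recursion:
  assumes "i \<ge> 1"
  shows "a i \<tau> = inverse (d_x f (a 0 \<tau>) (\<Lambda> \<tau>)) *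
     (deriv (a (i - 1)) \<tau> -
      (\<Sum>j=2..i. 1 / fact j * (d_x ^^ j) f (a 0 \<tau>) (\<Lambda> \<tau>) *
         (\<Sum>ks\<in>compositions j i. prod_list (map (\<lambda>k. a k \<tau>) ks))))"
proof -
  obtain n where i: "i = Suc n" using assms by (cases i) auto
  have "map (\<lambda>k. if k \<le> n then a k \<tau> else 0) ks = map (\<lambda>k. a k \<tau>) ks"
    if "j \<in> {2..Suc n}" "ks \<in> compositions j (Suc n)" for j ks
    using that compositions_part(2)[OF that(2)] by fastforce
  note P = arg_cong[where f=prod_list, OF this]
  have "(\<Sum>j=2..Suc n. 1 / fact j * (d_x ^^ j) f (x\<^sub>0 \<tau>) (\<Lambda> \<tau>) *
      (\<Sum>ks\<in>compositions j (Suc n). prod_list (map (\<lambda>k. if k \<le> n then a k \<tau> else 0) ks))) =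
    (\<Sum>j=2..Suc n. 1 / fact j * (d_x ^^ j) f (x\<^sub>0 \<tau>) (\<Lambda> \<tau>) *
      (\<Sum>ks\<in>compositions j (Suc n). prod_list (map (\<lambda>k. a k \<tau>) ks)))"
    by (intro sum.cong refl arg_cong2[where f="(*)"] P)
  then show ?thesis
    unfolding i slow_coeff.simps by (simp only: diff_Suc_1)
qed

lemma formal_coefficients_coeff: "formal_coefficients f \<Lambda> a"
  unfolding formal_coefficients_def
  using coeff_recursion coeff_smooth[of "Suc 0"] by (auto simp del: slow_coeff.simps)

text \<open>
  In the recursion for \<open>a (Suc n')\<close> the derivative of \<open>a n'\<close> tends to zero because \<open>a n'\<close> converges, and each
  product has a factor \<open>a k\<close> with \<open>1 \<le> k \<le> n'\<close>, which tends to zero by induction.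
\<close>
lemma coeff_tendsto_0:
  assumes L: "(\<Lambda> \<longlongrightarrow> l) Fl" and x: "(x\<^sub>0 \<longlongrightarrow> z) Fl"
    and shift: "\<And>\<delta>::real. filterlim (\<lambda>t. t + \<delta>) Fl Fl"
    and nz: "d_x f z l \<noteq> 0"
    and "n \<ge> 1"
  shows "(a n \<longlongrightarrow> 0) Fl"
  using \<open>n \<ge> 1\<close>
proof (induction n rule: less_induct)
  case (less n)
  obtain n' where n: "n = Suc n'" using less.prems by (cases n) auto
  have "\<exists>z. (a n' \<longlongrightarrow> z) Fl"
    using less.IH[of n'] x n by (cases "n' = 0") auto
  then have d: "(deriv (a n') \<longlongrightarrow> 0) Fl"
    using deriv_tendsto_zero[OF coeff_smooth _ shift] by blast
  have F: "((\<lambda>\<tau>. (d_x ^^ j) f (x\<^sub>0 \<tau>) (\<Lambda> \<tau>)) \<longlongrightarrow> (d_x ^^ j) f z l) Fl" for j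
    using Ck_plane_1_continuous[OF Ck_plane_d_x_iterate[OF f_smooth]] x L
    by (rule continuous_plane_tendsto)
  have P: "((\<lambda>\<tau>. prod_list (map (\<lambda>k. if k \<le> n' then a k \<tau> else 0) ks)) \<longlongrightarrow> 0) Fl"
    if "j \<in> {2..Suc n'}" "ks \<in> compositions j (Suc n')" for j ks
  proof -
    have "((\<lambda>\<tau>. if k \<le> n' then a k \<tau> else 0) \<longlongrightarrow> 0) Fl" if "k \<in> set ks" for k
      using less.IH[of k] n compositions_part(1)[OF \<open>ks \<in> _\<close> that] by (cases "k \<le> n'") auto
    then have "((\<lambda>\<tau>. prod_list (map (\<lambda>k. if k \<le> n' then a k \<tau> else 0) ks)) \<longlongrightarrow>
        prod_list (map (\<lambda>_. 0) ks)) Fl"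
      by (rule tendsto_prod_list)
    moreover have "prod_list (map (\<lambda>_. 0::real) ks) = 0"
      using that by (cases ks) (auto simp: compositions_def)
    ultimately show ?thesis by simp
  qed
  have "((\<lambda>\<tau>. inverse ((d_x ^^ 1) f (x\<^sub>0 \<tau>) (\<Lambda> \<tau>)) *
     (deriv (a n') \<tau> -
      (\<Sum>j=2..Suc n'. 1 / fact j * (d_x ^^ j) f (x\<^sub>0 \<tau>) (\<Lambda> \<tau>) *
         (\<Sum>ks\<in>compositions j (Suc n').
            prod_list (map (\<lambda>k. if k \<le> n' then a k \<tau> else 0) ks))))) \<longlongrightarrow>
     inverse ((d_x ^^ 1) f z l) * (0 - (\<Sum>j=2..Suc n'. 1 / fact j * (d_x ^^ j) f z l *
         (\<Sum>ks\<in>compositions j (Suc n'). 0)))) Fl"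
    by (intro tendsto_mult tendsto_diff tendsto_sum tendsto_inverse tendsto_const d F P)
       (use nz in auto)
  then show ?case by (simp add: n slow_coeff.simps(2))
qed

end

section \<open>Uniform expansions in powers of the small parameter\<close>

text \<open>
  The family \<open>u\<close> agrees with the power series \<open>A \<tau>\<close> in \<open>r\<close> up to order \<open>n\<close>, uniformly in \<open>\<tau>\<close>.  The whole
  series is recorded, rather than its first \<open>n + 1\<close> coefficients, so that the algebra of such expansions is
  the algebra of formal power series.
\<close>
definition expands :: "nat \<Rightarrow> (real \<Rightarrow> real \<Rightarrow> real) \<Rightarrow> (real \<Rightarrow> real fps) \<Rightarrow> bool" where
  "expands n u A \<longleftrightarrow> (\<forall>k. bounded (range (\<lambda>\<tau>. A \<tau> $ k))) \<and>
     (\<exists>K. \<forall>r\<in>{0..1}. \<forall>\<tau>. \<bar>u r \<tau> - (\<Sum>i\<le>n. A \<tau> $ i * r ^ i)\<bar> \<le> K * r ^ (n + 1))"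

text \<open>
  What is left over consists of the products \<open>A $ k * B $ l * r ^ (k + l)\<close> with \<open>k, l \<le> n < k + l\<close>: at most
  \<open>(n + 1)\<^sup>2\<close> terms, each of order \<open>r ^ (n + 1)\<close>.
\<close>
lemma fps_product_truncated:
  fixes A B :: "real fps"
  assumes r: "0 \<le> r" "r \<le> 1"
    and M: "\<And>k. k \<le> n \<Longrightarrow> \<bar>A $ k\<bar> \<le> M" and N: "\<And>k. k \<le> n \<Longrightarrow> \<bar>B $ k\<bar> \<le> N"
  shows "\<bar>(\<Sum>i\<le>n. A $ i * r ^ i) * (\<Sum>i\<le>n. B $ i * r ^ i) - (\<Sum>i\<le>n. (A * B) $ i * r ^ i)\<bar>
     \<le> real ((n + 1)\<^sup>2) * (M * N) * r ^ (n + 1)"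
proof -
  let ?t = "\<lambda>(k, l). A $ k * B $ l * r ^ (k + l)"
  let ?S = "{(k, l). k + l \<le> n}" and ?Q = "{..n} \<times> {..n}"
  have MN: "0 \<le> M" "0 \<le> N" using M[of 0] N[of 0] by auto
  have "(\<Sum>i\<le>n. A $ i * r ^ i) * (\<Sum>i\<le>n. B $ i * r ^ i) = sum ?t ?Q"
    by (simp add: sum_product sum.cartesian_product power_add mult_ac case_prod_unfold)
  moreover have "(\<Sum>i\<le>n. (A * B) $ i * r ^ i) = sum ?t ?S"
  proof -
    have "(\<Sum>i\<le>n. (A * B) $ i * r ^ i) = (\<Sum>i\<le>n. \<Sum>k\<le>i. A $ k * B $ (i - k) * r ^ (k + (i - k)))"
      by (intro sum.cong) (auto simp: fps_mult_nth sum_distrib_right atLeast0AtMost)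
    also have "\<dots> = sum ?t ?S"
      by (rule sum.triangle_reindex_eq[symmetric])
    finally show ?thesis .
  qed
  moreover have "sum ?t ?Q = sum ?t (?Q - ?S) + sum ?t ?S"
    by (rule sum.subset_diff) auto
  ultimately have "(\<Sum>i\<le>n. A $ i * r ^ i) * (\<Sum>i\<le>n. B $ i * r ^ i) - (\<Sum>i\<le>n. (A * B) $ i * r ^ i)
      = sum ?t (?Q - ?S)"
    by simp
  also have "\<bar>\<dots>\<bar> \<le> real (card (?Q - ?S)) * (M * N * r ^ (n + 1))"
  proof (rule order_trans[OF sum_abs sum_bounded_above])
    fix p assume p: "p \<in> ?Q - ?S"
    obtain k l where kl: "p = (k, l)" by (cases p)
    have "\<bar>A $ k\<bar> * \<bar>B $ l\<bar> * r ^ (k + l) \<le> M * N * r ^ (n + 1)"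
      using p kl r M[of k] N[of l] MN by (intro mult_mono power_decreasing) auto
    then show "\<bar>?t p\<bar> \<le> M * N * r ^ (n + 1)" using r by (simp add: kl abs_mult)
  qed
  also have "\<dots> \<le> real ((n + 1)\<^sup>2) * (M * N * r ^ (n + 1))"
  proof (rule mult_right_mono)
    have "card (?Q - ?S) \<le> card ?Q" by (rule card_mono) auto
    then show "real (card (?Q - ?S)) \<le> real ((n + 1)\<^sup>2)"
      by (simp only: of_nat_le_iff) (simp add: power2_eq_square)
  qed (use MN r in auto)
  finally show ?thesis by (simp add: mult.assoc)
qed

lemma expands_bounds:
  assumes "expands n u A"
  obtains K M where "0 \<le> K" "0 \<le> M" "\<And>k \<tau>. k \<le> n \<Longrightarrow> \<bar>A \<tau> $ k\<bar> \<le> M"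
    and "\<And>r \<tau>. 0 \<le> r \<Longrightarrow> r \<le> 1 \<Longrightarrow> \<bar>u r \<tau> - (\<Sum>i\<le>n. A \<tau> $ i * r ^ i)\<bar> \<le> K * r ^ (n + 1)"
proof -
  obtain K where K: "\<And>r \<tau>. 0 \<le> r \<Longrightarrow> r \<le> 1 \<Longrightarrow> \<bar>u r \<tau> - (\<Sum>i\<le>n. A \<tau> $ i * r ^ i)\<bar> \<le> K * r ^ (n + 1)"
    using assms unfolding expands_def by (metis atLeastAtMost_iff)
  have "\<forall>k. \<exists>b. \<forall>\<tau>. \<bar>A \<tau> $ k\<bar> \<le> b"
    using assms by (auto simp: expands_def bounded_iff)
  then obtain b where b: "\<And>k \<tau>. \<bar>A \<tau> $ k\<bar> \<le> b k" by metis
  have b0: "0 \<le> b k" for k using b[of undefined k] by linarith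
  show thesis
  proof (rule that[of K "\<Sum>k\<le>n. b k"])
    show "0 \<le> K" using K[of 1 undefined] by simp
    show "\<bar>A \<tau> $ k\<bar> \<le> (\<Sum>k\<le>n. b k)" if "k \<le> n" for k \<tau>
      using b[of \<tau> k] member_le_sum[of k "{..n}" b] b0 that by fastforce
  qed (fact K | simp add: sum_nonneg b0)+
qed

lemma expandsI:
  assumes "\<And>k. bounded (range (\<lambda>\<tau>. A \<tau> $ k))"
    and "\<And>r \<tau>. 0 \<le> r \<Longrightarrow> r \<le> 1 \<Longrightarrow> \<bar>u r \<tau> - (\<Sum>i\<le>n. A \<tau> $ i * r ^ i)\<bar> \<le> K * r ^ (n + 1)"
  shows "expands n u A"
  unfolding expands_def using assms by (metis atLeastAtMost_iff)

text \<open>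
  With \<open>U\<close>, \<open>V\<close> the truncations of \<open>A\<close>, \<open>B\<close> and \<open>W\<close> that of \<open>A * B\<close>, the error splits as
  \<open>u v - W = (u - U) v + U (v - V) + (U V - W)\<close>.
\<close>
lemma expands_mult:
  assumes u: "expands n u A" and v: "expands n v B"
  shows "expands n (\<lambda>r \<tau>. u r \<tau> * v r \<tau>) (\<lambda>\<tau>. A \<tau> * B \<tau>)"
proof -
  obtain K M where K: "0 \<le> K" "\<And>r \<tau>. 0 \<le> r \<Longrightarrow> r \<le> 1 \<Longrightarrow> \<bar>u r \<tau> - (\<Sum>i\<le>n. A \<tau> $ i * r ^ i)\<bar> \<le> K * r ^ (n + 1)"
    and M: "0 \<le> M" "\<And>k \<tau>. k \<le> n \<Longrightarrow> \<bar>A \<tau> $ k\<bar> \<le> M"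
    using expands_bounds[OF u] by metis
  obtain L N where L: "0 \<le> L" "\<And>r \<tau>. 0 \<le> r \<Longrightarrow> r \<le> 1 \<Longrightarrow> \<bar>v r \<tau> - (\<Sum>i\<le>n. B \<tau> $ i * r ^ i)\<bar> \<le> L * r ^ (n + 1)"
    and N: "0 \<le> N" "\<And>k \<tau>. k \<le> n \<Longrightarrow> \<bar>B \<tau> $ k\<bar> \<le> N"
    using expands_bounds[OF v] by metis
  have poly: "\<bar>\<Sum>i\<le>n. C $ i * r ^ i\<bar> \<le> real (n + 1) * M"
    if "0 \<le> r" "r \<le> 1" "\<And>k. k \<le> n \<Longrightarrow> \<bar>C $ k\<bar> \<le> M" "0 \<le> M" for C :: "real fps" and r M :: real
  proof -
    have "\<bar>C $ i * r ^ i\<bar> \<le> M" if "i \<le> n" for i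
    proof -
      have "\<bar>C $ i\<bar> * r ^ i \<le> M * 1"
        using that \<open>0 \<le> r\<close> \<open>r \<le> 1\<close> \<open>\<And>k. k \<le> n \<Longrightarrow> \<bar>C $ k\<bar> \<le> M\<close> \<open>0 \<le> M\<close>
        by (intro mult_mono power_le_one) auto
      then show ?thesis using \<open>0 \<le> r\<close> by (simp add: abs_mult)
    qed
    then have "(\<Sum>i\<le>n. \<bar>C $ i * r ^ i\<bar>) \<le> of_nat (card {..n}) * M"
      by (intro sum_bounded_above) auto
    then show ?thesis by (intro order_trans[OF sum_abs]) simp
  qed
  let ?G = "K * (L + real (n + 1) * N) + real (n + 1) * M * L + real ((n + 1)\<^sup>2) * (M * N)"
  have "\<bar>u r \<tau> * v r \<tau> - (\<Sum>i\<le>n. (A \<tau> * B \<tau>) $ i * r ^ i)\<bar> \<le> ?G * r ^ (n + 1)"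
    if r: "0 \<le> r" "r \<le> 1" for r \<tau>
  proof -
    let ?U = "\<Sum>i\<le>n. A \<tau> $ i * r ^ i" and ?V = "\<Sum>i\<le>n. B \<tau> $ i * r ^ i"
    let ?W = "\<Sum>i\<le>n. (A \<tau> * B \<tau>) $ i * r ^ i" and ?e = "r ^ (n + 1)"
    have e: "0 \<le> ?e" "?e \<le> 1" using r power_le_one[OF r, of "n + 1"] by auto
    have U: "\<bar>?U\<bar> \<le> real (n + 1) * M" and V: "\<bar>?V\<bar> \<le> real (n + 1) * N"
      by (rule poly[OF r]; use M N in blast)+
    have "\<bar>v r \<tau>\<bar> \<le> \<bar>v r \<tau> - ?V\<bar> + \<bar>?V\<bar>" by linarith
    also have "\<dots> \<le> L * 1 + real (n + 1) * N"
      using L(2)[OF r, of \<tau>] V mult_left_mono[OF e(2) L(1)] by linarith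
    finally have v: "\<bar>v r \<tau>\<bar> \<le> L + real (n + 1) * N" by simp
    have "\<bar>(u r \<tau> - ?U) * v r \<tau>\<bar> \<le> (K * ?e) * (L + real (n + 1) * N)"
      unfolding abs_mult using K(2)[OF r, of \<tau>] v K(1) e by (intro mult_mono) auto
    moreover have "\<bar>?U * (v r \<tau> - ?V)\<bar> \<le> (real (n + 1) * M) * (L * ?e)"
      unfolding abs_mult using L(2)[OF r, of \<tau>] U M(1)
      by (intro mult_mono) auto
    moreover have "\<bar>?U * ?V - ?W\<bar> \<le> real ((n + 1)\<^sup>2) * (M * N) * ?e"
      by (rule fps_product_truncated[OF r]; use M N in blast)
    moreover have "u r \<tau> * v r \<tau> - ?W = (u r \<tau> - ?U) * v r \<tau> + ?U * (v r \<tau> - ?V) + (?U * ?V - ?W)"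
      by (simp add: algebra_simps)
    moreover have "?G * ?e = (K * ?e) * (L + real (n + 1) * N) + (real (n + 1) * M) * (L * ?e)
        + real ((n + 1)\<^sup>2) * (M * N) * ?e"
      by (simp only: distrib_left distrib_right mult_ac)
    ultimately show ?thesis by linarith
  qed
  moreover have "bounded (range (\<lambda>\<tau>. (A \<tau> * B \<tau>) $ k))" for k
  proof -
    have "bounded (range (\<lambda>\<tau>. \<Sum>i\<in>I. A \<tau> $ i * B \<tau> $ (k - i)))" if "finite I" for I
      using that u v
      by (induction I) (auto intro!: bounded_plus_comp bounded_mult_comp simp: expands_def)
    then show ?thesis by (simp add: fps_mult_nth)
  qed
  ultimately show ?thesis by (intro expandsI)
qed

lemma expands_const:
  assumes "bounded (range g)"
  shows "expands n (\<lambda>r \<tau>. g \<tau>) (\<lambda>\<tau>. fps_const (g \<tau>))"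
proof -
  have "(\<Sum>i\<le>n. fps_const (g \<tau>) $ i * r ^ i) = g \<tau>" for \<tau> r
  proof -
    have "(\<Sum>i\<le>n. fps_const (g \<tau>) $ i * r ^ i) = (\<Sum>i\<in>{0}. fps_const (g \<tau>) $ i * r ^ i)"
      by (intro sum.mono_neutral_right) auto
    then show ?thesis by simp
  qed
  moreover have "bounded (range (\<lambda>\<tau>. fps_const (g \<tau>) $ k))" for k
    using assms by (cases "k = 0") auto
  ultimately show ?thesis by (auto simp: expands_def intro!: exI[of _ 0])
qed

lemma expands_add:
  assumes u: "expands n u A" and v: "expands n v B"
  shows "expands n (\<lambda>r \<tau>. u r \<tau> + v r \<tau>) (\<lambda>\<tau>. A \<tau> + B \<tau>)"
proof -
  obtain K where K: "\<And>r \<tau>. 0 \<le> r \<Longrightarrow> r \<le> 1 \<Longrightarrow> \<bar>u r \<tau> - (\<Sum>i\<le>n. A \<tau> $ i * r ^ i)\<bar> \<le> K * r ^ (n + 1)"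
    using expands_bounds[OF u] by metis
  obtain L where L: "\<And>r \<tau>. 0 \<le> r \<Longrightarrow> r \<le> 1 \<Longrightarrow> \<bar>v r \<tau> - (\<Sum>i\<le>n. B \<tau> $ i * r ^ i)\<bar> \<le> L * r ^ (n + 1)"
    using expands_bounds[OF v] by metis
  have "\<bar>u r \<tau> + v r \<tau> - (\<Sum>i\<le>n. (A \<tau> + B \<tau>) $ i * r ^ i)\<bar> \<le> (K + L) * r ^ (n + 1)"
    if r: "0 \<le> r" "r \<le> 1" for r \<tau>
    using K[OF r, of \<tau>] L[OF r, of \<tau>] by (simp add: distrib_right sum.distrib)
  moreover have "bounded (range (\<lambda>\<tau>. (A \<tau> + B \<tau>) $ k))" for k
    using u v by (auto intro!: bounded_plus_comp simp: expands_def)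
  ultimately show ?thesis by (intro expandsI)
qed

lemma expands_power:
  assumes "expands n u A"
  shows "expands n (\<lambda>r \<tau>. u r \<tau> ^ j) (\<lambda>\<tau>. A \<tau> ^ j)"
proof (induction j)
  case 0
  show ?case using expands_const[of "\<lambda>_. 1" n] by simp
next
  case (Suc j)
  show ?case using expands_mult[OF assms Suc] by simp
qed

lemma expands_sum:
  assumes "finite I" "\<And>j. j \<in> I \<Longrightarrow> expands n (u j) (A j)"
  shows "expands n (\<lambda>r \<tau>. \<Sum>j\<in>I. u j r \<tau>) (\<lambda>\<tau>. \<Sum>j\<in>I. A j \<tau>)"
  using assms
proof (induction I)
  case empty
  show ?case using expands_const[of "\<lambda>_. 0" n] by simp
next
  case (insert j I)
  then show ?case using expands_add[of n "u j" "A j"] by simp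
qed

text \<open>
  The coefficients of a power are sums over all lists of \<open>j\<close> exponents with total \<open>i\<close>; lists that contain
  a zero contribute nothing because the constant term vanishes.
\<close>
lemma fps_power_nth_compositions:
  fixes A :: "real fps"
  assumes A: "A $ 0 = 0" and j: "j \<ge> 1"
  shows "(A ^ j) $ i = (\<Sum>ks\<in>compositions j i. prod_list (map (($) A) ks))"
proof -
  obtain m where m: "j = Suc m" using j by (cases j) auto
  have "(A ^ j) $ i = (\<Sum>ks\<in>natpermute i j. \<Prod>l\<in>{0..m}. A $ (ks ! l))"
    unfolding m by (simp only: fps_power_nth diff_Suc_1 nat.simps if_False)
  also have "\<dots> = (\<Sum>ks\<in>natpermute i j. prod_list (map (($) A) ks))"
  proof (rule sum.cong)
    fix ks assume "ks \<in> natpermute i j"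
    then have "length ks = Suc m" by (simp add: natpermute_def m)
    then show "(\<Prod>l\<in>{0..m}. A $ (ks ! l)) = prod_list (map (($) A) ks)"
      by (simp add: prod.list_conv_set_nth atLeastLessThanSuc_atLeastAtMost)
  qed simp
  also have "\<dots> = (\<Sum>ks\<in>compositions j i. prod_list (map (($) A) ks))"
  proof (rule sum.mono_neutral_right)
    show "finite (natpermute i j)" by (rule natpermute_finite)
    show "compositions j i \<subseteq> natpermute i j"
      by (auto simp: compositions_def natpermute_def)
    show "\<forall>ks\<in>natpermute i j - compositions j i. prod_list (map (($) A) ks) = 0"
    proof
      fix ks assume "ks \<in> natpermute i j - compositions j i"
      then have "0 \<in> set ks"
        by (auto simp: compositions_def natpermute_def Suc_le_eq)
      then show "prod_list (map (($) A) ks) = 0"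
        using A by (force simp: prod_list_zero_iff)
    qed
  qed
  finally show ?thesis .
qed

section \<open>The residual of a truncation\<close>

lemma bounded_on_box:
  fixes G :: "real \<Rightarrow> real \<Rightarrow> real"
  assumes "continuous_on UNIV (\<lambda>(x, l). G x l)"
  obtains B where "B \<ge> 0" "\<And>x l. \<bar>x\<bar> \<le> R \<Longrightarrow> \<bar>l\<bar> \<le> R \<Longrightarrow> \<bar>G x l\<bar> \<le> B"
proof -
  have "compact ((\<lambda>(x, l). G x l) ` ({-R..R} \<times> {-R..R}))"
    by (intro compact_continuous_image compact_Times)
       (auto intro: continuous_on_subset[OF assms])
  then have "bounded ((\<lambda>(x, l). G x l) ` ({-R..R} \<times> {-R..R}))"
    by (rule compact_imp_bounded)
  then obtain B where B: "B > 0" "\<forall>x\<in>{-R..R}. \<forall>l\<in>{-R..R}. \<bar>G x l\<bar> \<le> B"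
    by (auto simp: bounded_pos)
  show thesis
  proof (rule that[of B])
    show "\<bar>G x l\<bar> \<le> B" if "\<bar>x\<bar> \<le> R" "\<bar>l\<bar> \<le> R" for x l
      using that B(2) by (simp add: abs_le_iff)
  qed (use B in simp)
qed

lemma taylor_in_x:
  assumes f: "\<And>k. Ck_plane k f"
  obtains K where "K \<ge> 0" "\<And>x h l. \<bar>x\<bar> \<le> R \<Longrightarrow> \<bar>x + h\<bar> \<le> R \<Longrightarrow> \<bar>l\<bar> \<le> R \<Longrightarrow>
     \<bar>f (x + h) l - (\<Sum>j\<le>n. (d_x ^^ j) f x l / fact j * h ^ j)\<bar> \<le> K * \<bar>h\<bar> ^ (n + 1)"
proof -
  obtain B where B: "B \<ge> 0" "\<And>x l. \<bar>x\<bar> \<le> R \<Longrightarrow> \<bar>l\<bar> \<le> R \<Longrightarrow> \<bar>(d_x ^^ (n + 1)) f x l\<bar> \<le> B"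
    using bounded_on_box[OF Ck_plane_1_continuous[OF Ck_plane_d_x_iterate[OF f]]] by metis
  have D: "DERIV (\<lambda>x. (d_x ^^ j) f x l) t :> (d_x ^^ Suc j) f t l" for j l t
  proof -
    have "Ck_plane (Suc 0) ((d_x ^^ j) f)" by (rule Ck_plane_d_x_iterate[OF f])
    then have "(\<lambda>x. (d_x ^^ j) f x l) field_differentiable (at t)" by simp
    then show ?thesis by (simp add: d_x_def field_differentiable_derivI)
  qed
  show thesis
  proof (rule that[of B])
    fix x h l assume xh: "\<bar>x\<bar> \<le> R" "\<bar>x + h\<bar> \<le> R" and l: "\<bar>l\<bar> \<le> R"
    show "\<bar>f (x + h) l - (\<Sum>j\<le>n. (d_x ^^ j) f x l / fact j * h ^ j)\<bar> \<le> B * \<bar>h\<bar> ^ (n + 1)"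
    proof (cases "h = 0")
      case True
      have "(\<Sum>j\<le>n. (d_x ^^ j) f x l / fact j * 0 ^ j) = (\<Sum>j\<in>{0}. (d_x ^^ j) f x l / fact j * 0 ^ j)"
        by (intro sum.mono_neutral_right) auto
      then show ?thesis using True by simp
    next
      case False
      have "\<exists>t. (if x + h < x then x + h < t \<and> t < x else x < t \<and> t < x + h) \<and>
        f (x + h) l = (\<Sum>j<Suc n. (d_x ^^ j) f x l / fact j * (x + h - x) ^ j)
          + (d_x ^^ Suc n) f t l / fact (Suc n) * (x + h - x) ^ Suc n"
        by (rule Taylor[where diff="\<lambda>j x. (d_x ^^ j) f x l" and a="-R" and b=R])
          (use D xh False in auto)
      from this[unfolded add_diff_cancel_left'] obtain t where t: "if x + h < x then x + h < t \<and> t < x else x < t \<and> t < x + h"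
        and eq: "f (x + h) l = (\<Sum>j<Suc n. (d_x ^^ j) f x l / fact j * h ^ j)
          + (d_x ^^ Suc n) f t l / fact (Suc n) * h ^ Suc n"
        by blast
      have "\<bar>t\<bar> \<le> R" using t xh by (auto split: if_splits)
      then have b: "\<bar>(d_x ^^ Suc n) f t l\<bar> \<le> B" using B(2) l by (simp only: Suc_eq_plus1)
      have "\<bar>(d_x ^^ Suc n) f t l / fact (Suc n)\<bar> \<le> B / 1"
        unfolding abs_divide using b B(1) by (intro frac_le) (auto simp del: funpow.simps fact_Suc)
      then have "\<bar>(d_x ^^ Suc n) f t l / fact (Suc n) * h ^ Suc n\<bar> \<le> B * \<bar>h\<bar> ^ Suc n"
        unfolding abs_mult power_abs by (intro mult_right_mono) auto
      moreover have "f (x + h) l - (\<Sum>j\<le>n. (d_x ^^ j) f x l / fact j * h ^ j)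
          = (d_x ^^ Suc n) f t l / fact (Suc n) * h ^ Suc n"
        unfolding eq lessThan_Suc_atMost by (rule add_diff_cancel_left')
      ultimately show ?thesis by (simp only: Suc_eq_plus1)
    qed
  qed (rule B)
qed

context slow_curve
begin

text \<open>
  The formal series without its leading term \<open>x\<^sub>0\<close>.
\<close>
abbreviation deviation :: "real \<Rightarrow> real fps" where
  "deviation \<tau> \<equiv> Abs_fps (\<lambda>i. if i = 0 then 0 else a i \<tau>)"

abbreviation taylor_coeff :: "nat \<Rightarrow> real \<Rightarrow> real" where
  "taylor_coeff j \<tau> \<equiv> (d_x ^^ j) f (x\<^sub>0 \<tau>) (\<Lambda> \<tau>) / fact j"

text \<open>
  Inserting the formal series in the Taylor expansion of \<open>f\<close> gives the formal derivative multiplied by \<open>r\<close>: solved for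
  \<open>a i\<close>, the coefficient of \<open>r ^ i\<close> is the recursion that defines \<open>a i\<close>.
\<close>
lemma formal_equation:
  assumes "i \<le> n"
  shows "(\<Sum>j\<le>n. fps_const (taylor_coeff j \<tau>) * deviation \<tau> ^ j) $ i
    = (if i = 0 then 0 else deriv (a (i - 1)) \<tau>)"
proof -
  let ?c = "\<lambda>j. taylor_coeff j \<tau>" and ?A = "deviation \<tau>"
  have nth: "(\<Sum>j\<le>n. fps_const (?c j) * ?A ^ j) $ i = (\<Sum>j\<le>n. ?c j * (?A ^ j) $ i)"
    by (simp add: fps_sum_nth)
  show ?thesis
  proof (cases "i = 0")
    case True
    have "?c j * (?A ^ j) $ 0 = 0" for j
      using on_curve by (cases j) (auto simp: fps_power_zeroth)
    then have "(\<Sum>j\<le>n. ?c j * (?A ^ j) $ 0) = 0"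
      by (intro sum.neutral) blast
    then show ?thesis using nth unfolding True by (simp only: simp_thms if_True)
  next
    case False
    have comp: "(?A ^ j) $ i = (\<Sum>ks\<in>compositions j i. prod_list (map (\<lambda>k. a k \<tau>) ks))" if "j \<ge> 1" for j
    proof -
      have "map (($) ?A) ks = map (\<lambda>k. a k \<tau>) ks" if "ks \<in> compositions j i" for ks
        using that by (auto simp: compositions_def)
      note P = arg_cong[where f=prod_list, OF this]
      show ?thesis
        using that by (subst fps_power_nth_compositions) (auto intro!: sum.cong P)
    qed
    have n: "n \<ge> 1" using False assms by simp
    have "{..n} = insert 0 (insert 1 {2..n})" using n by auto
    then have "(\<Sum>j\<le>n. ?c j * (?A ^ j) $ i)
        = ?c 0 * (?A ^ 0) $ i + (?c 1 * (?A ^ 1) $ i + (\<Sum>j=2..n. ?c j * (?A ^ j) $ i))"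
      by (simp del: power_0 power_one_right)
    \<comment> \<open>The linear term is the only one that contains \<open>a i\<close> itself.\<close>
    also have "\<dots> = d_x f (x\<^sub>0 \<tau>) (\<Lambda> \<tau>) * a i \<tau> + (\<Sum>j=2..n. ?c j * (?A ^ j) $ i)"
      using False by simp
    also have "(\<Sum>j=2..n. ?c j * (?A ^ j) $ i) = (\<Sum>j=2..i. ?c j * (?A ^ j) $ i)"
    proof (rule sum.mono_neutral_right)
      show "\<forall>j\<in>{2..n} - {2..i}. ?c j * (?A ^ j) $ i = 0"
        using comp compositions_empty by auto
    qed (use assms in auto)
    also have "\<dots> = (\<Sum>j=2..i. 1 / fact j * (d_x ^^ j) f (a 0 \<tau>) (\<Lambda> \<tau>) *
        (\<Sum>ks\<in>compositions j i. prod_list (map (\<lambda>k. a k \<tau>) ks)))"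
      by (intro sum.cong) (auto simp: comp)
    also have "d_x f (x\<^sub>0 \<tau>) (\<Lambda> \<tau>) * a i \<tau> + \<dots> = deriv (a (i - 1)) \<tau>"
      using coeff_recursion[of i \<tau>] False fx_nonzero[of \<tau>] by (simp add: field_simps)
    finally show ?thesis using nth False by simp
  qed
qed

lemma coeff_bound:
  obtains M where "M \<ge> 0" "\<And>i \<tau>. i \<le> n \<Longrightarrow> \<bar>a i \<tau>\<bar> \<le> M"
proof -
  have "\<forall>i. \<exists>b. \<forall>\<tau>. \<bar>a i \<tau>\<bar> \<le> b"
    using Ck_bounded_imp_bounded[OF coeff_smooth[of 0]] by (auto simp: bounded_iff)
  then obtain b where b: "\<And>i \<tau>. \<bar>a i \<tau>\<bar> \<le> b i" by metis
  have b0: "0 \<le> b i" for i using b[of i undefined] by linarith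
  show thesis
  proof (rule that[of "\<Sum>i\<le>n. b i"])
    show "\<bar>a i \<tau>\<bar> \<le> (\<Sum>i\<le>n. b i)" if "i \<le> n" for i \<tau>
      using b[of i \<tau>] member_le_sum[of i "{..n}" b] b0 that by fastforce
  qed (simp add: sum_nonneg b0)
qed

lemma truncation_split: "(\<Sum>i\<le>n. a i \<tau> * r ^ i) = x\<^sub>0 \<tau> + (\<Sum>i=1..n. a i \<tau> * r ^ i)"
proof -
  have "{..n} = insert 0 {1..n}" by auto
  then show ?thesis by simp
qed

lemma deviation_bound:
  obtains M where "M \<ge> 0"
    "\<And>r \<tau>. 0 \<le> r \<Longrightarrow> r \<le> 1 \<Longrightarrow> \<bar>\<Sum>i=1..n. a i \<tau> * r ^ i\<bar> \<le> M * r"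
proof -
  obtain M where M: "M \<ge> 0" "\<And>i \<tau>. i \<le> n \<Longrightarrow> \<bar>a i \<tau>\<bar> \<le> M"
    using coeff_bound by blast
  show thesis
  proof (rule that[of "real n * M"])
    fix r \<tau> :: real assume r: "0 \<le> r" "r \<le> 1"
    have "\<bar>a i \<tau> * r ^ i\<bar> \<le> M * r" if "i \<in> {1..n}" for i
    proof -
      have "r ^ i \<le> r ^ 1" using that r by (intro power_decreasing) auto
      then have "\<bar>a i \<tau>\<bar> * r ^ i \<le> M * r" using M that r by (intro mult_mono) auto
      then show ?thesis using r by (simp add: abs_mult)
    qed
    then have "(\<Sum>i=1..n. \<bar>a i \<tau> * r ^ i\<bar>) \<le> of_nat (card {1..n}) * (M * r)"
      by (rule sum_bounded_above)
    then show "\<bar>\<Sum>i=1..n. a i \<tau> * r ^ i\<bar> \<le> real n * M * r"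
      by (intro order_trans[OF sum_abs]) (simp add: mult.assoc)
  qed (use M in simp)
qed

text \<open>
  Three errors are added up: the Taylor remainder of \<open>f\<close>, which is of order \<open>\<bar>h\<bar> ^ (n + 1)\<close> with \<open>h = O(r)\<close>; the
  truncation of the powers of \<open>h\<close>; and the term \<open>deriv (a n) \<tau> * r ^ (n + 1)\<close> of the derivative, which the expansion of
  \<open>f\<close> up to order \<open>n\<close> does not match.
\<close>
lemma residual_bound:
  obtains K where "K \<ge> 0"
    "\<And>r \<tau>. 0 \<le> r \<Longrightarrow> r \<le> 1 \<Longrightarrow>
       \<bar>f (\<Sum>i\<le>n. a i \<tau> * r ^ i) (\<Lambda> \<tau>) - (\<Sum>i\<le>n. deriv (a i) \<tau> * r ^ (i + 1))\<bar> \<le> K * r ^ (n + 1)"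
proof -
  let ?h = "\<lambda>r \<tau>. \<Sum>i=1..n. a i \<tau> * r ^ i"
  let ?T = "\<lambda>r \<tau>. \<Sum>j\<le>n. taylor_coeff j \<tau> * ?h r \<tau> ^ j"
  let ?S = "\<lambda>\<tau>. \<Sum>j\<le>n. fps_const (taylor_coeff j \<tau>) * deviation \<tau> ^ j"
  obtain M where M: "M \<ge> 0" "\<And>r \<tau>. 0 \<le> r \<Longrightarrow> r \<le> 1 \<Longrightarrow> \<bar>?h r \<tau>\<bar> \<le> M * r"
    using deviation_bound by blast
  obtain R1 where R1: "\<And>\<tau>. \<bar>x\<^sub>0 \<tau>\<bar> \<le> R1" using curve_bounded by (auto simp: bounded_iff)
  obtain R2 where R2: "\<And>\<tau>. \<bar>\<Lambda> \<tau>\<bar> \<le> R2" using Ck_bounded_imp_bounded[OF \<Lambda>_smooth] by (auto simp: bounded_iff)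
  have R0: "0 \<le> R1" "0 \<le> R2" using R1[of 0] R2[of 0] by linarith+
  define R where "R = R1 + R2 + M"
  obtain K1 where K1: "K1 \<ge> 0" "\<And>x h l. \<bar>x\<bar> \<le> R \<Longrightarrow> \<bar>x + h\<bar> \<le> R \<Longrightarrow> \<bar>l\<bar> \<le> R \<Longrightarrow>
     \<bar>f (x + h) l - (\<Sum>j\<le>n. (d_x ^^ j) f x l / fact j * h ^ j)\<bar> \<le> K1 * \<bar>h\<bar> ^ (n + 1)"
    using taylor_in_x[OF f_smooth] by blast
  have h: "expands n ?h deviation"
  proof (rule expandsI[where K=0])
    show "bounded (range (\<lambda>\<tau>. deviation \<tau> $ k))" for k
      using Ck_bounded_imp_bounded[OF coeff_smooth[of 0 k]] by (cases "k = 0") auto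
    have "(\<Sum>i\<le>n. deviation \<tau> $ i * r ^ i) = ?h r \<tau>" for r \<tau>
    proof -
      have "{..n} = insert 0 {1..n}" by auto
      then show ?thesis by simp
    qed
    then show "\<bar>?h r \<tau> - (\<Sum>i\<le>n. deviation \<tau> $ i * r ^ i)\<bar> \<le> 0 * r ^ (n + 1)" for r \<tau> by simp
  qed
  have c: "bounded (range (\<lambda>\<tau>. taylor_coeff j \<tau>))" for j
    using Ck_bounded_imp_bounded[OF Ck_bounded_mult[OF partial_smooth[of 0 j] Ck_bounded_const[of 0 "1 / fact j"]]] by simp
  have "expands n ?T ?S"
    by (intro expands_sum expands_mult[OF expands_const[OF c] expands_power[OF h]]) simp
  then obtain K2 where K2: "K2 \<ge> 0"
    "\<And>r \<tau>. 0 \<le> r \<Longrightarrow> r \<le> 1 \<Longrightarrow> \<bar>?T r \<tau> - (\<Sum>i\<le>n. ?S \<tau> $ i * r ^ i)\<bar> \<le> K2 * r ^ (n + 1)"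
    by (rule expands_bounds) blast
  obtain K3 where K3: "\<And>\<tau>. \<bar>deriv (a n) \<tau>\<bar> \<le> K3"
  proof -
    have "bounded (range (deriv (a n)))"
      using coeff_smooth[of "Suc 0" n] by simp
    then show thesis using that by (auto simp: bounded_iff)
  qed
  have K30: "K3 \<ge> 0" using K3[of 0] by linarith
  show thesis
  proof (rule that[of "K1 * M ^ (n + 1) + K2 + K3"])
    show "0 \<le> K1 * M ^ (n + 1) + K2 + K3" using K1(1) K2(1) K30 M(1) by simp
    fix r \<tau> :: real assume r: "0 \<le> r" "r \<le> 1"
    have hM: "\<bar>?h r \<tau>\<bar> \<le> M * r" by (rule M(2)[OF r])
    also have "M * r \<le> M" using M(1) r by (simp add: mult_left_le)
    finally have "\<bar>?h r \<tau>\<bar> \<le> M" .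
    then have "\<bar>f (x\<^sub>0 \<tau> + ?h r \<tau>) (\<Lambda> \<tau>) - ?T r \<tau>\<bar> \<le> K1 * \<bar>?h r \<tau>\<bar> ^ (n + 1)"
      using R1[of \<tau>] R2[of \<tau>] R0 M(1) by (intro K1(2)) (auto simp: R_def)
    also have "\<dots> \<le> K1 * (M * r) ^ (n + 1)"
      using hM K1(1) by (intro mult_left_mono power_mono) auto
    also have "\<dots> = K1 * M ^ (n + 1) * r ^ (n + 1)"
      by (simp only: power_mult_distrib mult.assoc)
    finally have e1: "\<bar>f (x\<^sub>0 \<tau> + ?h r \<tau>) (\<Lambda> \<tau>) - ?T r \<tau>\<bar> \<le> K1 * M ^ (n + 1) * r ^ (n + 1)" .
    have "(\<Sum>i\<le>n. ?S \<tau> $ i * r ^ i) = (\<Sum>i\<le>n. (if i = 0 then 0 else deriv (a (i - 1)) \<tau>) * r ^ i)"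
      by (intro sum.cong) (auto simp del: fps_sum_nth simp: formal_equation)
    also have "\<dots> = (\<Sum>i<n. deriv (a i) \<tau> * r ^ (i + 1))"
      unfolding lessThan_Suc_atMost[symmetric] sum.lessThan_Suc_shift by simp
    finally have "(\<Sum>i\<le>n. deriv (a i) \<tau> * r ^ (i + 1)) - (\<Sum>i\<le>n. ?S \<tau> $ i * r ^ i)
        = deriv (a n) \<tau> * r ^ (n + 1)"
      by (simp add: lessThan_Suc_atMost[symmetric])
    moreover have "\<bar>deriv (a n) \<tau> * r ^ (n + 1)\<bar> \<le> K3 * r ^ (n + 1)"
      using K3[of \<tau>] r by (simp add: abs_mult mult_right_mono)
    ultimately have e3: "\<bar>(\<Sum>i\<le>n. deriv (a i) \<tau> * r ^ (i + 1)) - (\<Sum>i\<le>n. ?S \<tau> $ i * r ^ i)\<bar> \<le> K3 * r ^ (n + 1)"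
      by (simp only:)
    show "\<bar>f (\<Sum>i\<le>n. a i \<tau> * r ^ i) (\<Lambda> \<tau>) - (\<Sum>i\<le>n. deriv (a i) \<tau> * r ^ (i + 1))\<bar>
        \<le> (K1 * M ^ (n + 1) + K2 + K3) * r ^ (n + 1)"
      unfolding truncation_split distrib_right using e1 e3 K2(2)[OF r, of \<tau>] by linarith
  qed
qed

end

section \<open>Barriers\<close>

text \<open>
  At the first time at which \<open>w\<close> reaches \<open>c\<close> its derivative cannot be negative, since \<open>w\<close> was smaller before; but the
  hypothesis says that it is negative there.
\<close>
lemma stays_below_barrier:
  fixes w :: "real \<Rightarrow> real" and b :: ereal
  assumes lim: "(w \<longlongrightarrow> 0) at_bot" and c: "c > 0"
    and D: "\<And>t. ereal t < b \<Longrightarrow> DERIV w t :> w' t"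
    and inward: "\<And>t. ereal t < b \<Longrightarrow> w t = c \<Longrightarrow> w' t < 0"
    and t1: "ereal t1 < b"
  shows "w t1 < c"
proof (rule ccontr)
  assume "\<not> w t1 < c"
  then have wt1: "c \<le> w t1" by simp
  have before: "ereal t < b" if "t \<le> t1" for t
    using that t1 by (metis ereal_less_eq(3) le_less_trans)
  obtain N where N: "\<And>t. t \<le> N \<Longrightarrow> w t < c"
    using order_tendstoD(2)[OF lim c] by (auto simp: eventually_at_bot_linorder)
  define t0 where "t0 = min N (t1 - 1)"
  have t0: "t0 < t1" "w t0 < c" using N[of t0] by (auto simp: t0_def)
  have cont: "continuous_on {t0..t1} w"
    using DERIV_isCont[OF D[OF before]] by (intro continuous_at_imp_continuous_on) auto
  define S where "S = {t0..t1} \<inter> w -` {c..}"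
  have S: "closed S" "S \<noteq> {}" "bdd_below S"
  proof -
    show "closed S" unfolding S_def by (intro continuous_closed_preimage cont) auto
    have "t1 \<in> S" using wt1 t0 by (simp add: S_def)
    then show "S \<noteq> {}" by blast
    show "bdd_below S" by (rule bdd_belowI[of _ t0]) (simp add: S_def)
  qed
  \<comment> \<open>The first time at which the barrier is reached.\<close>
  define s where "s = Inf S"
  have sS: "s \<in> S" unfolding s_def by (rule closed_contains_Inf[OF S(2,3,1)])
  have least: "s \<le> u" if "u \<in> S" for u
    unfolding s_def using S(3) that by (rule cInf_lower[rotated])
  have s: "t0 \<le> s" "s \<le> t1" "c \<le> w s" using sS by (auto simp: S_def)
  have "\<exists>u. t0 \<le> u \<and> u \<le> s \<and> w u = c"
    using t0 s cont by (intro IVT') (auto intro: continuous_on_subset)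
  then obtain u where u: "t0 \<le> u" "u \<le> s" "w u = c" by blast
  then have "u \<in> S" using s by (auto simp: S_def)
  with least u have ws: "w s = c" by fastforce
  have "w' s < 0" using inward[OF before[OF s(2)] ws] .
  then obtain d where d: "d > 0" "\<And>h. 0 < h \<Longrightarrow> h < d \<Longrightarrow> w s < w (s - h)"
    using DERIV_neg_dec_left[OF D[OF before[OF s(2)]]] by blast
  have ts: "t0 < s" using s t0 ws by (cases "t0 = s") auto
  define h where "h = min d (s - t0) / 2"
  have h: "0 < h" "h < d" "t0 \<le> s - h" using d(1) ts by (auto simp: h_def min_def field_simps)
  then have "c < w (s - h)" using d(2) ws by simp
  then have "s - h \<in> S" using h s by (auto simp: S_def)
  then show False using least h by fastforce
qed

lemma stays_between_barriers:
  fixes w :: "real \<Rightarrow> real" and b :: ereal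
  assumes lim: "(w \<longlongrightarrow> 0) at_bot" and c: "c > 0"
    and D: "\<And>t. ereal t < b \<Longrightarrow> DERIV w t :> w' t"
    and inward: "\<And>t. ereal t < b \<Longrightarrow> w t = c \<Longrightarrow> w' t < 0"
      "\<And>t. ereal t < b \<Longrightarrow> w t = - c \<Longrightarrow> w' t > 0"
    and t: "ereal t < b"
  shows "\<bar>w t\<bar> < c"
proof -
  have "w t < c" by (rule stays_below_barrier[OF lim c D inward(1) t])
  moreover have "- w t < c"
  proof (rule stays_below_barrier[where w="\<lambda>t. - w t" and w'="\<lambda>t. - w' t" and b=b])
    show "((\<lambda>t. - w t) \<longlongrightarrow> 0) at_bot" using tendsto_minus[OF lim] by simp
    show "DERIV (\<lambda>t. - w t) t :> - w' t" if "ereal t < b" for t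
      using D[OF that] by (rule DERIV_minus)
    show "- w' t < 0" if "ereal t < b" "- w t = c" for t
      using inward(2)[of t] that by auto
  qed (use c t in auto)
  ultimately show ?thesis by simp
qed

section \<open>Continuation of solutions\<close>

text \<open>
  Banach's fixed point theorem for the integral operator, applied on a closed ball of bounded continuous
  functions on the whole line; outside the interval the functions are frozen at its end points.  The
  step \<open>\<delta>\<close> is limited by \<open>R\<close>, \<open>M\<close> and \<open>L\<close> but not by the initial point, which is what continuation needs.
\<close>
lemma picard_forward:
  fixes g :: "real \<Rightarrow> real \<Rightarrow> real"
  assumes cont: "continuous_on UNIV (\<lambda>(t, x). g t x)"
    and M: "\<And>t x. \<bar>g t x\<bar> \<le> M"
    and L: "\<And>t x y. \<bar>t\<bar> \<le> R + 1 \<Longrightarrow> \<bar>x\<bar> \<le> R + 1 \<Longrightarrow> \<bar>y\<bar> \<le> R + 1 \<Longrightarrow> \<bar>g t x - g t y\<bar> \<le> L * \<bar>x - y\<bar>"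
    and L0: "0 \<le> L"
    and \<delta>: "0 < \<delta>" "\<delta> \<le> 1" "M * \<delta> \<le> 1" "L * \<delta> \<le> 1 / 2"
    and start: "\<bar>t0\<bar> \<le> R" "\<bar>x0\<bar> \<le> R"
  obtains y where "y t0 = x0"
    "\<And>t. t \<in> {t0..t0 + \<delta>} \<Longrightarrow> (y has_real_derivative g t (y t)) (at t within {t0..t0 + \<delta>})"
proof -
  \<comment> \<open>Projection of time onto the interval, so that the operator acts on functions on the whole line.\<close>
  define cl where "cl t = max t0 (min t (t0 + \<delta>))" for t
  have cl_mem: "cl t \<in> {t0..t0 + \<delta>}" for t using \<delta> by (auto simp: cl_def)
  define F where "F y t = x0 + integral {t0..t} (\<lambda>s. g s (apply_bcontfun y s))" for y :: "real \<Rightarrow>\<^sub>C real" and t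
  have G: "continuous_on I (\<lambda>s. g s (apply_bcontfun y s))" for I and y :: "real \<Rightarrow>\<^sub>C real"
    using continuous_on_compose2[OF cont, of I "\<lambda>s. (s, apply_bcontfun y s)"]
    by (simp add: continuous_on_Pair)
  have DF: "(F y has_real_derivative g t (apply_bcontfun y t)) (at t within {t0..t0 + \<delta>})"
    if "t \<in> {t0..t0 + \<delta>}" for y t
    unfolding F_def using integral_has_real_derivative[OF G that]
    by (auto intro!: derivative_eq_intros)
  have M0: "0 \<le> M" using M[of 0 0] by linarith
  have len: "B * (t - t0) \<le> B * \<delta>" if "t \<in> {t0..t0 + \<delta>}" "0 \<le> B" for B t
    using that by (intro mult_left_mono) auto
  have FR: "\<bar>F y t\<bar> \<le> R + 1" if t: "t \<in> {t0..t0 + \<delta>}" for y t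
  proof -
    have "norm (integral {t0..t} (\<lambda>s. g s (apply_bcontfun y s))) \<le> M * (t - t0)"
      using t M G by (intro integral_bound) auto
    then show ?thesis using len[OF t M0] \<delta>(3) start(2) by (simp add: F_def)
  qed
  have "(\<lambda>t. F y (cl t)) \<in> bcontfun" for y
  proof -
    have "continuous_on {t0..t0 + \<delta>} (F y)"
      by (rule DERIV_continuous_on) (rule DF)
    moreover have "continuous_on UNIV cl"
      unfolding cl_def by (intro continuous_intros)
    ultimately have "continuous_on UNIV (\<lambda>t. F y (cl t))"
      by (rule continuous_on_compose2) (use cl_mem in blast)
    moreover have "bounded (range (\<lambda>t. F y (cl t)))"
      using FR[OF cl_mem] by (auto simp: bounded_iff)
    ultimately show ?thesis by (simp add: bcontfun_def)
  qed
  define P where "P y = Bcontfun (\<lambda>t. F y (cl t))" for y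
  have P: "apply_bcontfun (P y) t = F y (cl t)" for y t
    unfolding P_def using \<open>\<And>y. (\<lambda>t. F y (cl t)) \<in> bcontfun\<close> by (simp add: Bcontfun_inverse)
  define S :: "(real \<Rightarrow>\<^sub>C real) set" where "S = cball (const_bcontfun 0) (R + 1)"
  have S_bound: "\<bar>apply_bcontfun y t\<bar> \<le> R + 1" if "y \<in> S" for y t
    using that dist_bounded[of "const_bcontfun 0" t y]
    by (simp add: S_def const_bcontfun.rep_eq dist_real_def)
  have P_S: "P y \<in> S" for y
    unfolding S_def mem_cball
    by (rule dist_bound) (simp add: const_bcontfun.rep_eq P dist_real_def FR[OF cl_mem])
  have contraction: "dist (P y) (P z) \<le> 1 / 2 * dist y z" if yz: "y \<in> S" "z \<in> S" for y z
  proof (rule dist_bound)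
    fix t
    let ?D = "dist y z"
    have "F y (cl t) - F z (cl t)
        = integral {t0..cl t} (\<lambda>s. g s (apply_bcontfun y s) - g s (apply_bcontfun z s))"
      unfolding F_def by (simp add: integral_diff integrable_continuous_real G)
    also have "norm \<dots> \<le> L * ?D * (cl t - t0)"
    proof (rule integral_bound)
      show "norm (g s (apply_bcontfun y s) - g s (apply_bcontfun z s)) \<le> L * ?D"
        if "s \<in> {t0..cl t}" for s
      proof -
        have "\<bar>s\<bar> \<le> R + 1" using that cl_mem[of t] start(1) \<delta>(2) by auto
        then have "\<bar>g s (apply_bcontfun y s) - g s (apply_bcontfun z s)\<bar>
            \<le> L * \<bar>apply_bcontfun y s - apply_bcontfun z s\<bar>"
          using S_bound yz by (intro L) auto
        also have "\<dots> \<le> L * ?D"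
          using dist_bounded[of y s z] L0 by (intro mult_left_mono) (auto simp: dist_real_def)
        finally show ?thesis by simp
      qed
    qed (use cl_mem[of t] G in \<open>auto intro!: continuous_on_diff\<close>)
    also have "L * ?D * (cl t - t0) \<le> L * ?D * \<delta>"
      using L0 by (intro len cl_mem) simp
    also have "\<dots> = L * \<delta> * ?D" by simp
    also have "\<dots> \<le> 1 / 2 * ?D" using \<delta>(4) by (intro mult_right_mono) auto
    finally show "dist (apply_bcontfun (P y) t) (apply_bcontfun (P z) t) \<le> 1 / 2 * ?D"
      by (simp add: P dist_real_def)
  qed
  have "\<exists>!y. y \<in> S \<and> P y = y"
  proof (rule Banach_fix[where c="1/2"])
    show "complete S" unfolding S_def by (simp add: complete_eq_closed)
    show "S \<noteq> {}" using P_S by blast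
    show "P ` S \<subseteq> S" using P_S by blast
  qed (use contraction in auto)
  then obtain y where y: "P y = y" by blast
  have fix_point: "apply_bcontfun y t = F y t" if "t \<in> {t0..t0 + \<delta>}" for t
    using P[of y t] that by (simp add: y cl_def)
  show thesis
  proof (rule that[of "apply_bcontfun y"])
    show "apply_bcontfun y t0 = x0" using fix_point[of t0] \<delta> by (simp add: F_def)
    show "(apply_bcontfun y has_real_derivative g t (apply_bcontfun y t)) (at t within {t0..t0 + \<delta>})"
      if t: "t \<in> {t0..t0 + \<delta>}" for t
    proof (rule has_field_derivative_transform_within[OF DF[OF t], where d=1])
      show "F y t' = apply_bcontfun y t'" if "t' \<in> {t0..t0 + \<delta>}" for t'
        using fix_point[OF that] by simp
    qed (use t in auto)
  qed
qed

lemma DERIV_glue: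
  fixes x y :: "real \<Rightarrow> real"
  assumes x: "DERIV x s :> D" and y: "(y has_real_derivative D) (at_right s)" and eq: "y s = x s"
  shows "DERIV (\<lambda>t. if t \<le> s then x t else y t) s :> D"
proof -
  let ?z = "\<lambda>t. if t \<le> s then x t else y t"
  have "((\<lambda>t. (x t - x s) / (t - s)) \<longlongrightarrow> D) (at_left s)"
    using x unfolding has_field_derivative_iff by (rule filterlim_mono) (auto simp: at_le)
  then have "((\<lambda>t. (?z t - ?z s) / (t - s)) \<longlongrightarrow> D) (at_left s)"
    by (rule Lim_transform_eventually) (auto simp: eventually_at_filter)
  moreover have "((\<lambda>t. (y t - y s) / (t - s)) \<longlongrightarrow> D) (at_right s)"
    using y unfolding has_field_derivative_iff .
  then have "((\<lambda>t. (?z t - ?z s) / (t - s)) \<longlongrightarrow> D) (at_right s)"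
    by (rule Lim_transform_eventually) (auto simp: eventually_at_filter eq)
  ultimately show ?thesis
    unfolding has_field_derivative_iff by (rule filterlim_split_at)
qed

text \<open>
  Since \<open>g\<close> is bounded, \<open>x\<close> stays bounded on \<open>[T - 1, T)\<close>.  So Picard's step has a uniform length there and,
  begun close enough to \<open>T\<close>, leads beyond \<open>T\<close>.
\<close>
lemma solution_extends:
  fixes g :: "real \<Rightarrow> real \<Rightarrow> real"
  assumes cont: "continuous_on UNIV (\<lambda>(t, x). g t x)"
    and M: "\<And>t x. \<bar>g t x\<bar> \<le> M"
    and lipschitz: "\<And>R. \<exists>L\<ge>0. \<forall>t x y. \<bar>t\<bar> \<le> R \<longrightarrow> \<bar>x\<bar> \<le> R \<longrightarrow> \<bar>y\<bar> \<le> R \<longrightarrow> \<bar>g t x - g t y\<bar> \<le> L * \<bar>x - y\<bar>"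
    and x: "\<And>t. t < T \<Longrightarrow> DERIV x t :> g t (x t)"
  obtains z T' where "T < T'" "\<And>t. t < T' \<Longrightarrow> DERIV z t :> g t (z t)"
    "eventually (\<lambda>t. z t = x t) at_bot"
proof -
  have M0: "0 \<le> M" using M[of 0 0] by linarith
  define R where "R = max (\<bar>T\<bar> + 1) (\<bar>x (T - 1)\<bar> + M)"
  obtain L where L: "L \<ge> 0" "\<And>t x y. \<bar>t\<bar> \<le> R + 1 \<Longrightarrow> \<bar>x\<bar> \<le> R + 1 \<Longrightarrow> \<bar>y\<bar> \<le> R + 1 \<Longrightarrow> \<bar>g t x - g t y\<bar> \<le> L * \<bar>x - y\<bar>"
    using lipschitz[of "R + 1"] by blast
  define \<delta> where "\<delta> = 1 / (2 * (M + L + 1))"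
  have \<delta>: "0 < \<delta>" "\<delta> \<le> 1" "M * \<delta> \<le> 1" "L * \<delta> \<le> 1 / 2"
    using M0 L(1) by (auto simp: \<delta>_def divide_simps)
  define s where "s = T - \<delta> / 2"
  have s: "T - 1 < s" "s < T" "T < s + \<delta>" using \<delta> by (auto simp: s_def)
  obtain \<xi> where "x s - x (T - 1) = (s - (T - 1)) * g \<xi> (x \<xi>)"
    using MVT2[of "T - 1" s x "\<lambda>t. g t (x t)"] x s by auto
  then have "\<bar>x s - x (T - 1)\<bar> \<le> 1 * M"
    unfolding \<open>x s - _ = _\<close> abs_mult using M s by (intro mult_mono) auto
  then have xs: "\<bar>x s\<bar> \<le> R" by (simp add: R_def)
  have sR: "\<bar>s\<bar> \<le> R" using s by (auto simp: R_def)
  obtain y where y: "y s = x s"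
    "\<And>t. t \<in> {s..s + \<delta>} \<Longrightarrow> (y has_real_derivative g t (y t)) (at t within {s..s + \<delta>})"
    using picard_forward[OF cont M L(2,1) \<delta> sR xs] by blast
  define z where "z t = (if t \<le> s then x t else y t)" for t
  show thesis
  proof (rule that[of "s + \<delta>" z])
    show "eventually (\<lambda>t. z t = x t) at_bot"
      unfolding eventually_at_bot_linorder z_def by auto
    show "DERIV z t :> g t (z t)" if t: "t < s + \<delta>" for t
    proof (cases t s rule: linorder_cases)
      case less
      have "DERIV z t :> g t (x t)"
      proof (rule has_field_derivative_transform_within_open[of x])
        show "DERIV x t :> g t (x t)" using x s less by auto
        show "t \<in> {..<s}" using less by simp
      qed (auto simp: z_def)
      then show ?thesis using less by (simp add: z_def)
    next
      case greater
      have "DERIV z t :> g t (y t)"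
      proof (rule has_field_derivative_transform_within_open[of y])
        show "DERIV y t :> g t (y t)"
          using y(2)[of t] greater t by (simp add: at_within_Icc_at)
        show "t \<in> {s<..}" using greater by simp
      qed (auto simp: z_def)
      then show ?thesis using greater by (simp add: z_def)
    next
      case equal
      have "DERIV (\<lambda>t. if t \<le> s then x t else y t) s :> g s (x s)"
      proof (rule DERIV_glue)
        show "DERIV x s :> g s (x s)" using x s by auto
        show "(y has_real_derivative g s (x s)) (at_right s)"
          using y(2)[of s] y(1) \<delta> by (simp add: at_within_Icc_at_right)
      qed (rule y)
      then show ?thesis unfolding equal z_def by simp
    qed
  qed (use s in simp)
qed

section \<open>Solutions near a truncation\<close>

context slow_curve
begin

lemma truncation_tendsto:
  assumes "(\<Lambda> \<longlongrightarrow> l) Fl" "(x\<^sub>0 \<longlongrightarrow> z) Fl" "\<And>\<delta>::real. filterlim (\<lambda>t. t + \<delta>) Fl Fl"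
    and nz: "d_x f z l \<noteq> 0"
  shows "((\<lambda>\<tau>. \<Sum>i\<le>n. a i \<tau> * r ^ i) \<longlongrightarrow> z) Fl"
proof -
  have "((\<lambda>\<tau>. x\<^sub>0 \<tau> + (\<Sum>i=1..n. a i \<tau> * r ^ i)) \<longlongrightarrow> z + (\<Sum>i=1..n. 0 * r ^ i)) Fl"
    by (intro tendsto_intros assms(2) coeff_tendsto_0[OF assms]) auto
  then show ?thesis by (simp add: truncation_split)
qed

text \<open>
  The second derivative of \<open>f\<close> in \<open>x\<close> is bounded near the curve, so the linearisation changes by at most
  \<open>m / 2\<close> in a tube of fixed width around it.
\<close>
lemma uniform_hyperbolicity:
  obtains \<eta> where "\<eta> > 0"
    "\<And>\<sigma> \<tau> y. \<bar>\<sigma>\<bar> = 1 \<Longrightarrow> \<sigma> * d_x f (x\<^sub>0 \<tau>) (\<Lambda> \<tau>) < 0 \<Longrightarrow> \<bar>y - x\<^sub>0 \<tau>\<bar> \<le> 2 * \<eta> \<Longrightarrow>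
       \<sigma> * d_x f y (\<Lambda> \<tau>) \<le> - m / 2"
proof -
  obtain R1 where R1: "\<And>\<tau>. \<bar>x\<^sub>0 \<tau>\<bar> \<le> R1" using curve_bounded by (auto simp: bounded_iff)
  obtain R2 where R2: "\<And>\<tau>. \<bar>\<Lambda> \<tau>\<bar> \<le> R2" using Ck_bounded_imp_bounded[OF \<Lambda>_smooth] by (auto simp: bounded_iff)
  have R0: "0 \<le> R1" "0 \<le> R2" using R1[of 0] R2[of 0] by linarith+
  obtain B where B: "B \<ge> 0"
    "\<And>x l. \<bar>x\<bar> \<le> R1 + R2 + 1 \<Longrightarrow> \<bar>l\<bar> \<le> R1 + R2 + 1 \<Longrightarrow> \<bar>(d_x ^^ 2) f x l\<bar> \<le> B"
    using bounded_on_box[OF Ck_plane_1_continuous[OF Ck_plane_d_x_iterate[OF f_smooth]]] by metis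
  define \<eta> where "\<eta> = min 1 (m / (2 * (B + 1))) / 2"
  have \<eta>: "\<eta> > 0" "2 * \<eta> \<le> 1" using m_pos B(1) by (auto simp: \<eta>_def)
  have "B * (2 * \<eta>) \<le> (B + 1) * (m / (2 * (B + 1)))"
    using B(1) m_pos by (intro mult_mono) (auto simp: \<eta>_def)
  also have "\<dots> = m / 2" using B(1) by (simp add: field_simps)
  finally have B\<eta>: "B * (2 * \<eta>) \<le> m / 2" .
  show thesis
  proof (rule that[OF \<eta>(1)])
    fix \<sigma> \<tau> y :: real
    assume \<sigma>: "\<bar>\<sigma>\<bar> = 1" "\<sigma> * d_x f (x\<^sub>0 \<tau>) (\<Lambda> \<tau>) < 0" and y: "\<bar>y - x\<^sub>0 \<tau>\<bar> \<le> 2 * \<eta>"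
    have "Ck_plane (Suc 0) (d_x f)" using f_smooth[of "Suc (Suc 0)"] by simp
    then have "(\<lambda>u. d_x f u (\<Lambda> \<tau>)) field_differentiable (at z)" for z by simp
    from mean_value_near[OF this, of "x\<^sub>0 \<tau>" y]
    obtain \<xi> where \<xi>: "\<bar>\<xi> - x\<^sub>0 \<tau>\<bar> \<le> \<bar>y - x\<^sub>0 \<tau>\<bar>"
      "d_x f y (\<Lambda> \<tau>) - d_x f (x\<^sub>0 \<tau>) (\<Lambda> \<tau>) = d_x (d_x f) \<xi> (\<Lambda> \<tau>) * (y - x\<^sub>0 \<tau>)"
      unfolding d_x_def[of "d_x f"] by blast
    have "\<bar>(d_x ^^ 2) f \<xi> (\<Lambda> \<tau>)\<bar> \<le> B"
      using \<xi>(1) y \<eta>(2) R1[of \<tau>] R2[of \<tau>] R0 by (intro B(2)) auto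
    then have "\<bar>d_x (d_x f) \<xi> (\<Lambda> \<tau>)\<bar> \<le> B" by (simp add: numeral_2_eq_2)
    then have "\<bar>d_x f y (\<Lambda> \<tau>) - d_x f (x\<^sub>0 \<tau>) (\<Lambda> \<tau>)\<bar> \<le> B * (2 * \<eta>)"
      unfolding \<xi>(2) abs_mult using y B(1) by (intro mult_mono) auto
    then have "\<bar>\<sigma> * d_x f y (\<Lambda> \<tau>) - \<sigma> * d_x f (x\<^sub>0 \<tau>) (\<Lambda> \<tau>)\<bar> \<le> m / 2"
      using B\<eta> \<sigma>(1) by (simp add: abs_mult flip: right_diff_distrib)
    moreover have "m \<le> \<bar>\<sigma> * d_x f (x\<^sub>0 \<tau>) (\<Lambda> \<tau>)\<bar>"
      using normally_hyperbolic[of \<tau>] \<sigma>(1) by (simp add: abs_mult)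
    ultimately show "\<sigma> * d_x f y (\<Lambda> \<tau>) \<le> - m / 2" using \<sigma>(2) by linarith
  qed
qed

text \<open>
  For \<open>\<sigma> = 1\<close> the function \<open>z\<close> is a solution of the nonautonomous problem, for \<open>\<sigma> = -1\<close> a solution run backwards in time;
  in both cases the curve attracts \<open>z\<close>.  The constant \<open>C\<close> exceeds \<open>2 * K / m\<close>, the ratio of the residual
  to the guaranteed rate of contraction, so that \<open>\<plusminus> C * r ^ (n + 1)\<close> are barriers for the difference.
\<close>
lemma solution_tracks_truncation:
  assumes \<sigma>: "\<bar>\<sigma>\<bar> = 1" and attracting: "\<And>\<tau>. \<sigma> * d_x f (x\<^sub>0 \<tau>) (\<Lambda> \<tau>) < 0"
  obtains C rbar where "C > 0" "rbar > 0"
    "\<And>r z b t. 0 < r \<Longrightarrow> r < rbar \<Longrightarrow>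
       (\<And>t. ereal t < b \<Longrightarrow> DERIV z t :> \<sigma> * f (z t) (\<Lambda> (r * (\<sigma> * t)))) \<Longrightarrow>
       ((\<lambda>t. z t - (\<Sum>i\<le>n. a i (r * (\<sigma> * t)) * r ^ i)) \<longlongrightarrow> 0) at_bot \<Longrightarrow>
       ereal t < b \<Longrightarrow> \<bar>z t - (\<Sum>i\<le>n. a i (r * (\<sigma> * t)) * r ^ i)\<bar> < C * r ^ (n + 1)"
proof -
  obtain \<eta> where \<eta>: "\<eta> > 0"
    "\<And>\<tau> y. \<bar>y - x\<^sub>0 \<tau>\<bar> \<le> 2 * \<eta> \<Longrightarrow> \<sigma> * d_x f y (\<Lambda> \<tau>) \<le> - m / 2"
    using uniform_hyperbolicity \<sigma> attracting by metis
  obtain K where K: "K \<ge> 0"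
    "\<And>r \<tau>. 0 \<le> r \<Longrightarrow> r \<le> 1 \<Longrightarrow>
       \<bar>f (\<Sum>i\<le>n. a i \<tau> * r ^ i) (\<Lambda> \<tau>) - (\<Sum>i\<le>n. deriv (a i) \<tau> * r ^ (i + 1))\<bar> \<le> K * r ^ (n + 1)"
    using residual_bound by blast
  obtain M where M: "M \<ge> 0"
    "\<And>r \<tau>. 0 \<le> r \<Longrightarrow> r \<le> 1 \<Longrightarrow> \<bar>\<Sum>i=1..n. a i \<tau> * r ^ i\<bar> \<le> M * r"
    using deviation_bound by blast
  define C where "C = 2 * K / m + 1"
  have C: "C > 0" "m / 2 * C > K" using K(1) m_pos by (auto simp: C_def field_simps add_pos_nonneg)
  \<comment> \<open>For such \<open>r\<close> the truncation is \<open>\<eta>\<close>-close to the curve and the barriers are \<open>\<eta>\<close>-close to the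
    truncation, hence the region between them lies in the tube of \<open>uniform_hyperbolicity\<close>.\<close>
  define rbar where "rbar = min 1 (\<eta> / (M + C))"
  have rbar: "rbar > 0" using \<eta>(1) M(1) C(1) by (simp add: rbar_def)
  show thesis
  proof (rule that[OF C(1) rbar])
    fix r z b t
    assume r: "0 < r" "r < rbar"
      and z: "\<And>t. ereal t < b \<Longrightarrow> DERIV z t :> \<sigma> * f (z t) (\<Lambda> (r * (\<sigma> * t)))"
      and lim: "((\<lambda>t. z t - (\<Sum>i\<le>n. a i (r * (\<sigma> * t)) * r ^ i)) \<longlongrightarrow> 0) at_bot"
      and t: "ereal t < b"
    have r1: "0 \<le> r" "r \<le> 1" using r by (auto simp: rbar_def)
    have "r * (M + C) \<le> \<eta>"
      using r M(1) C(1) by (simp add: rbar_def pos_less_divide_eq less_imp_le)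
    then have "M * r + C * r \<le> \<eta>" by (simp add: algebra_simps)
    moreover have "0 \<le> M * r" "0 \<le> C * r" using M(1) C(1) r(1) by simp_all
    ultimately have small: "M * r \<le> \<eta>" "C * r \<le> \<eta>" by linarith+
    let ?Y = "\<lambda>t. \<Sum>i\<le>n. a i (r * (\<sigma> * t)) * r ^ i"
    let ?Y' = "\<lambda>t. \<Sum>i\<le>n. deriv (a i) (r * (\<sigma> * t)) * r ^ (i + 1)"
    let ?w' = "\<lambda>t. \<sigma> * f (z t) (\<Lambda> (r * (\<sigma> * t))) - \<sigma> * ?Y' t"
    define c where "c = C * r ^ (n + 1)"
    have c: "c > 0" using C(1) r(1) by (simp add: c_def)
    have "r ^ (n + 1) \<le> r ^ 1" using r1 by (intro power_decreasing) auto
    then have c_small: "c \<le> \<eta>" using small(2) C(1) mult_left_mono[of "r ^ (n + 1)" r C]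
      unfolding c_def power_one_right by linarith
    have "K * r ^ (n + 1) < m / 2 * C * r ^ (n + 1)" using C(2) r(1) by (intro mult_strict_right_mono) auto
    then have Kc: "K * r ^ (n + 1) < m / 2 * c" by (simp add: c_def mult.assoc)
    \<comment> \<open>Multiplication by the sign \<open>w / c\<close> of \<open>w\<close> covers the upper and the lower barrier at once.\<close>
    have inward: "?w' t * (w / c) < 0"
      if w: "z t - ?Y t = w" "\<bar>w\<bar> = c" for t w
    proof -
      let ?\<tau> = "r * (\<sigma> * t)"
      have fd: "(\<lambda>u. f u (\<Lambda> ?\<tau>)) field_differentiable (at u)" for u
        using f_smooth[of "Suc 0"] by simp
      obtain \<xi> where \<xi>: "\<bar>\<xi> - ?Y t\<bar> \<le> \<bar>z t - ?Y t\<bar>"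
        "f (z t) (\<Lambda> ?\<tau>) - f (?Y t) (\<Lambda> ?\<tau>) = d_x f \<xi> (\<Lambda> ?\<tau>) * (z t - ?Y t)"
        using mean_value_near[OF fd, of "?Y t" "z t"] unfolding d_x_def by blast
      have "\<bar>?Y t - x\<^sub>0 ?\<tau>\<bar> \<le> M * r"
        using M(2)[OF r1, of ?\<tau>] by (simp add: truncation_split)
      then have "\<bar>\<xi> - x\<^sub>0 ?\<tau>\<bar> \<le> 2 * \<eta>" using \<xi>(1) w c_small small(1) by linarith
      then have neg: "\<sigma> * d_x f \<xi> (\<Lambda> ?\<tau>) \<le> - m / 2" by (rule \<eta>(2))
      let ?\<rho> = "\<sigma> * (f (?Y t) (\<Lambda> ?\<tau>) - ?Y' t)"
      have \<rho>: "\<bar>?\<rho>\<bar> \<le> K * r ^ (n + 1)"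
        using K(2)[OF r1, of ?\<tau>] \<sigma> by (simp add: abs_mult)
      have split: "?w' t = \<sigma> * d_x f \<xi> (\<Lambda> ?\<tau>) * w + ?\<rho>"
        using \<xi>(2) w(1) by (simp add: algebra_simps)
      consider "w = c" | "w = - c" using w(2) by linarith
      then show ?thesis
      proof cases
        case 1
        have "\<sigma> * d_x f \<xi> (\<Lambda> ?\<tau>) * c \<le> - m / 2 * c" using neg c by (intro mult_right_mono) auto
        then have "?w' t < 0" unfolding split 1 using \<rho> Kc by linarith
        then show ?thesis using 1 c by simp
      next
        case 2
        have "\<sigma> * d_x f \<xi> (\<Lambda> ?\<tau>) * c \<le> - m / 2 * c" using neg c by (intro mult_right_mono) auto
        then have "?w' t > 0" unfolding split 2 using \<rho> Kc by linarith
        then show ?thesis using 2 c by simp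
      qed
    qed
    have "\<bar>z t - ?Y t\<bar> < c"
    proof (rule stays_between_barriers[where w="\<lambda>t. z t - ?Y t" and w'="?w'" and b=b])
      show "DERIV (\<lambda>t. z t - ?Y t) t :> ?w' t" if "ereal t < b" for t
      proof -
        have a: "DERIV (\<lambda>t. a i (r * (\<sigma> * t)) * r ^ i) t :> \<sigma> * (deriv (a i) (r * (\<sigma> * t)) * r ^ (i + 1))" for i
        proof -
          have "DERIV (\<lambda>t. a i (r * (\<sigma> * t))) t :> deriv (a i) (r * (\<sigma> * t)) * (r * \<sigma>)"
            by (rule DERIV_chain2[OF Ck_bounded_DERIV[OF coeff_smooth]]) (auto intro!: derivative_eq_intros)
          from DERIV_cmult_right[OF this, of "r ^ i"] show ?thesis
            by (simp add: mult_ac)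
        qed
        have "DERIV ?Y t :> (\<Sum>i\<le>n. \<sigma> * (deriv (a i) (r * (\<sigma> * t)) * r ^ (i + 1)))"
          by (intro DERIV_sum a)
        then show ?thesis using DERIV_diff[OF z[OF that]] by (simp add: sum_distrib_left)
      qed
      show "?w' t < 0" if "z t - ?Y t = c" for t
        using inward[OF that] c by simp
      show "0 < ?w' t" if "z t - ?Y t = - c" for t
        using inward[OF that] c by simp
    qed (use lim c t in auto)
    then show "\<bar>z t - ?Y t\<bar> < C * r ^ (n + 1)" by (simp add: c_def)
  qed
qed

text \<open>
  The first derivative of \<open>f\<close> in \<open>x\<close> is bounded on compact sets, which gives the Lipschitz
  condition of \<open>solution_extends\<close>.
\<close>
lemma solution_continues:
  assumes f_bounded: "bounded (range (\<lambda>(x, l). f x l))" and \<sigma>: "\<bar>\<sigma>\<bar> = 1"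
    and z: "\<And>t. t < T \<Longrightarrow> DERIV z t :> \<sigma> * f (z t) (\<Lambda> (r * (\<sigma> * t)))"
  obtains y T' where "T < T'" "\<And>t. t < T' \<Longrightarrow> DERIV y t :> \<sigma> * f (y t) (\<Lambda> (r * (\<sigma> * t)))"
    "eventually (\<lambda>t. y t = z t) at_bot"
proof -
  let ?g = "\<lambda>t x. \<sigma> * f x (\<Lambda> (r * (\<sigma> * t)))"
  obtain M where M: "\<And>x l. \<bar>f x l\<bar> \<le> M" using f_bounded by (auto simp: bounded_iff)
  obtain R2 where R2: "\<And>\<tau>. \<bar>\<Lambda> \<tau>\<bar> \<le> R2" using Ck_bounded_imp_bounded[OF \<Lambda>_smooth] by (auto simp: bounded_iff)
  have cont: "continuous_on UNIV (\<lambda>(t, x). ?g t x)"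
  proof -
    have "continuous_on UNIV (\<lambda>p. \<Lambda> (r * (\<sigma> * fst p)))"
      by (rule continuous_on_compose2[OF Ck_bounded_continuous[OF \<Lambda>_smooth]]) (auto intro!: continuous_intros)
    then have "continuous_on UNIV (\<lambda>p. (snd p, \<Lambda> (r * (\<sigma> * fst p))))"
      by (intro continuous_intros)
    then have "continuous_on UNIV (\<lambda>p. f (snd p) (\<Lambda> (r * (\<sigma> * fst p))))"
      using continuous_on_compose2[OF Ck_plane_1_continuous[OF f_smooth]] by fastforce
    then show ?thesis by (simp add: case_prod_unfold continuous_on_mult_left)
  qed
  have bound: "\<bar>?g t x\<bar> \<le> M" for t x using M \<sigma> by (simp add: abs_mult)
  have lip: "\<exists>L\<ge>0. \<forall>t x y. \<bar>t\<bar> \<le> R \<longrightarrow> \<bar>x\<bar> \<le> R \<longrightarrow> \<bar>y\<bar> \<le> R \<longrightarrow> \<bar>?g t x - ?g t y\<bar> \<le> L * \<bar>x - y\<bar>" for R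
  proof -
    have "Ck_plane (Suc 0) (d_x f)" using f_smooth[of "Suc (Suc 0)"] by simp
    then obtain B where B: "B \<ge> 0"
      "\<And>x l. \<bar>x\<bar> \<le> 3 * \<bar>R\<bar> + R2 \<Longrightarrow> \<bar>l\<bar> \<le> 3 * \<bar>R\<bar> + R2 \<Longrightarrow> \<bar>d_x f x l\<bar> \<le> B"
      using bounded_on_box[OF Ck_plane_1_continuous] by metis
    have "\<bar>?g t x - ?g t y\<bar> \<le> B * \<bar>x - y\<bar>" if "\<bar>x\<bar> \<le> R" "\<bar>y\<bar> \<le> R" for t x y
    proof -
      let ?l = "\<Lambda> (r * (\<sigma> * t))"
      have fd: "(\<lambda>u. f u ?l) field_differentiable (at u)" for u
        using f_smooth[of "Suc 0"] by simp
      obtain \<xi> where \<xi>: "\<bar>\<xi> - y\<bar> \<le> \<bar>x - y\<bar>" "f x ?l - f y ?l = d_x f \<xi> ?l * (x - y)"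
        using mean_value_near[OF fd, of y x] unfolding d_x_def by blast
      have "\<bar>d_x f \<xi> ?l\<bar> \<le> B"
        using \<xi>(1) that R2[of "r * (\<sigma> * t)"] by (intro B(2)) auto
      then have "\<bar>f x ?l - f y ?l\<bar> \<le> B * \<bar>x - y\<bar>"
        unfolding \<xi>(2) abs_mult by (intro mult_right_mono) auto
      then show ?thesis using \<sigma> by (simp add: abs_mult flip: right_diff_distrib)
    qed
    then show ?thesis using B(1) by blast
  qed
  show thesis using solution_extends[OF cont bound lip z] that by blast
qed

end

section \<open>Series for the pullback solutions\<close>

text \<open>
  A supremum of strictly bounded quantities need not be strictly bounded; hence the room between \<open>K'\<close> and \<open>K\<close>.
\<close>
lemma estimate_onI:
  assumes "I \<subseteq> D" "\<And>t. t \<in> I \<Longrightarrow> \<bar>s t - x t\<bar> \<le> K'" "K' < K"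
  shows "estimate_on I D s x K"
proof -
  have "sup_norm I (\<lambda>t. s t - x t) \<le> ereal K'"
    unfolding sup_norm_def using assms(2) by (intro SUP_least) simp
  then show ?thesis using assms(1,3) unfolding estimate_on_def
    by (meson ereal_less(2) less_ereal.simps(1) le_less_trans)
qed

lemma estimate_on_weaken: "estimate_on I D s x K \<Longrightarrow> K \<le> K' \<Longrightarrow> estimate_on I D s x K'"
  unfolding estimate_on_def using less_le_trans ereal_less_eq(3) by blast

lemma power_less_of_less_root:
  assumes "r > 0" "C > 0" "\<epsilon> > 0" "r < root (n + 1) (\<epsilon> / C)"
  shows "C * r ^ (n + 1) < \<epsilon>"
proof -
  have "r ^ (n + 1) < root (n + 1) (\<epsilon> / C) ^ (n + 1)"
    using assms by (intro power_strict_mono) auto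
  also have "\<dots> = \<epsilon> / C" using assms by (intro real_root_pow_pos2) auto
  finally show ?thesis using assms(2) by (simp add: field_simps)
qed

lemma filterlim_shift_at_top: "filterlim (\<lambda>t. t + \<delta>) at_top (at_top :: real filter)"
  using filterlim_tendsto_add_at_top[OF tendsto_const[of \<delta>] filterlim_ident] by (simp add: add.commute)

lemma filterlim_shift_at_bot: "filterlim (\<lambda>t. t + \<delta>) at_bot (at_bot :: real filter)"
  by (auto simp: filterlim_at_bot eventually_at_bot_linorder le_diff_eq[symmetric])

text \<open>
  The bound \<open>m\<close> is the minimum of \<open>\<bar>\<partial>\<^sub>xf\<bar>\<close> over the compact curve of equilibria.
\<close>
lemma slow_curve_of_equilibria:
  assumes f: "\<And>k. Ck_plane k f" and \<Lambda>: "\<And>k. Ck_bounded k \<Lambda>" and range: "range \<Lambda> \<subseteq> {lm..lp}"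
    and X: "continuous_on {lm..lp} X" and zero: "\<And>l. l \<in> {lm..lp} \<Longrightarrow> f (X l) l = 0"
    and nz: "\<And>l. l \<in> {lm..lp} \<Longrightarrow> d_x f (X l) l \<noteq> 0"
  obtains m where "slow_curve f \<Lambda> (\<lambda>\<tau>. X (\<Lambda> \<tau>)) m"
proof -
  have \<Lambda>_mem: "\<Lambda> \<tau> \<in> {lm..lp}" for \<tau> using range by blast
  have "Ck_plane (Suc 0) (d_x f)" using f[of "Suc (Suc 0)"] by simp
  then have "continuous_on {lm..lp} (\<lambda>l. d_x f (X l) l)"
    using continuous_on_compose2[OF Ck_plane_1_continuous continuous_on_Pair[OF X continuous_on_id]]
    by simp
  then have cont: "continuous_on {lm..lp} (\<lambda>l. \<bar>d_x f (X l) l\<bar>)"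
    by (intro continuous_intros)
  have "{lm..lp} \<noteq> {}" using \<Lambda>_mem by blast
  from continuous_attains_inf[OF compact_Icc this cont]
  obtain l where l: "l \<in> {lm..lp}" "\<And>l'. l' \<in> {lm..lp} \<Longrightarrow> \<bar>d_x f (X l) l\<bar> \<le> \<bar>d_x f (X l') l'\<bar>"
    by blast
  have "slow_curve f \<Lambda> (\<lambda>\<tau>. X (\<Lambda> \<tau>)) \<bar>d_x f (X l) l\<bar>"
  proof
    show "continuous_on UNIV (\<lambda>\<tau>. X (\<Lambda> \<tau>))"
      using continuous_on_compose2[OF X Ck_bounded_continuous[OF \<Lambda>]] \<Lambda>_mem by blast
    have "bounded (X ` {lm..lp})"
      by (intro compact_imp_bounded compact_continuous_image X) simp
    then show "bounded (range (\<lambda>\<tau>. X (\<Lambda> \<tau>)))"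
      by (rule bounded_subset) (use \<Lambda>_mem in blast)
    show "\<bar>d_x f (X l) l\<bar> > 0" using nz[OF l(1)] by simp
  qed (rule f \<Lambda> zero[OF \<Lambda>_mem] l(2)[OF \<Lambda>_mem])+
  then show thesis by (rule that)
qed

context slow_curve
begin

lemma truncation_tendsto_slow:
  assumes lims: "(\<Lambda> \<longlongrightarrow> l) Fl" "(x\<^sub>0 \<longlongrightarrow> z) Fl" "\<And>\<delta>::real. filterlim (\<lambda>t. t + \<delta>) Fl Fl"
    and nz: "d_x f z l \<noteq> 0" and scale: "filterlim (\<lambda>t. r * t) Fl Fl"
  shows "(partial_sum a n r \<longlongrightarrow> z) Fl"
  unfolding partial_sum_def
  by (rule filterlim_compose[OF truncation_tendsto[OF lims nz] scale])

text \<open>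
  Common to both directions of time.  The sets \<open>J \<beta>\<close> are the half-lines with end point \<open>\<beta>\<close> that are neighbourhoods
  of the end \<open>Fl\<close> at which the solution is anchored, and \<open>e\<close> is the end point for which the half-line is the whole line:
  \<open>\<infinity>\<close> for half-lines unbounded to the left, \<open>-\<infinity>\<close> for half-lines unbounded to the right.
\<close>
lemma series_of_tracking:
  assumes tracking: "\<And>n. \<exists>C>0. \<exists>rbar>0. \<forall>r t. 0 < r \<longrightarrow> r < rbar \<longrightarrow>
      \<bar>partial_sum a n r t - x r t\<bar> \<le> C * r ^ (n + 1)"
    and global: "\<And>r. r > 0 \<Longrightarrow> D r = UNIV"
    and diff_lim: "\<And>n r. r > 0 \<Longrightarrow> ((\<lambda>t. partial_sum a n r t - x r t) \<longlongrightarrow> 0) Fl"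
    and J: "J e = UNIV" "\<And>P. eventually P Fl \<Longrightarrow> \<exists>\<beta>. \<beta> \<noteq> - e \<and> (\<forall>t\<in>J \<beta>. P t)"
    and e: "e \<noteq> - e"
  shows "\<exists>(a :: nat \<Rightarrow> real \<Rightarrow> real) (C :: nat \<Rightarrow> real) (rbar :: nat \<Rightarrow> real).
        (\<forall>n. continuous_on UNIV (a n) \<and> bounded (range (a n))) \<and>
        a 0 = x\<^sub>0 \<and>
        (\<forall>n. C n > 0 \<and> rbar n > 0) \<and>
        (\<forall>n r. 0 < r \<and> r < rbar n \<longrightarrow>
           estimate_on UNIV (D r) (partial_sum a n r) (x r) (C n * r ^ (n + 1))) \<and>
        asymptotic_series D x a \<and>
        formal_coefficients f \<Lambda> a \<and>
        (\<exists>\<beta> :: real \<Rightarrow> nat \<Rightarrow> real \<Rightarrow> ereal. \<forall>\<epsilon>>0. \<forall>n. \<forall>r>0.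
           \<beta> \<epsilon> n r \<noteq> - e \<and>
           estimate_on (J (\<beta> \<epsilon> n r)) (D r) (partial_sum a n r) (x r) \<epsilon> \<and>
           (r < min (rbar n) (root (n + 1) (\<epsilon> / C n)) \<longrightarrow> \<beta> \<epsilon> n r = e))"
proof -
  obtain K rbar where K: "\<And>n. K n > 0" and rbar: "\<And>n. rbar n > 0"
    and bound: "\<And>n r t. 0 < r \<Longrightarrow> r < rbar n \<Longrightarrow> \<bar>partial_sum a n r t - x r t\<bar> \<le> K n * r ^ (n + 1)"
    using tracking by metis
  define C where "C n = K n + 1" for n
  have C: "C n > 0" for n using K[of n] by (simp add: C_def)
  have est: "estimate_on UNIV (D r) (partial_sum a n r) (x r) (C n * r ^ (n + 1))"
    if r: "0 < r" "r < rbar n" for n r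
    by (rule estimate_onI[where K'="K n * r ^ (n + 1)"]) (use bound global r in \<open>auto simp: C_def\<close>)
  have asym: "asymptotic_series D x a"
    unfolding asymptotic_series_def Suc_eq_plus1 using est C rbar by blast
  have "\<exists>\<beta>. \<epsilon> > 0 \<longrightarrow> r > 0 \<longrightarrow> \<beta> \<noteq> - e \<and>
      estimate_on (J \<beta>) (D r) (partial_sum a n r) (x r) \<epsilon> \<and>
      (r < min (rbar n) (root (n + 1) (\<epsilon> / C n)) \<longrightarrow> \<beta> = e)" for \<epsilon> n r
  proof (cases "\<epsilon> > 0 \<and> r > 0")
    case True
    then have pos: "\<epsilon> > 0" "r > 0" by auto
    show ?thesis
    proof (cases "r < min (rbar n) (root (n + 1) (\<epsilon> / C n))")
      case True
      have "C n * r ^ (n + 1) \<le> \<epsilon>"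
        using power_less_of_less_root[of r "C n" \<epsilon> n] pos C True by simp
      then have "estimate_on (J e) (D r) (partial_sum a n r) (x r) \<epsilon>"
        unfolding J(1) using estimate_on_weaken[OF est] pos True by simp
      then show ?thesis using e by blast
    next
      case False
      have "eventually (\<lambda>t. \<bar>partial_sum a n r t - x r t\<bar> < \<epsilon> / 2) Fl"
        using tendstoD[OF diff_lim[OF pos(2), of n], of "\<epsilon> / 2"] pos(1) by simp
      then obtain \<beta> where \<beta>: "\<beta> \<noteq> - e" "\<And>t. t \<in> J \<beta> \<Longrightarrow> \<bar>partial_sum a n r t - x r t\<bar> < \<epsilon> / 2"
        using J(2) by blast
      have "estimate_on (J \<beta>) (D r) (partial_sum a n r) (x r) \<epsilon>"
        by (rule estimate_onI[where K'="\<epsilon> / 2"])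
          (use \<beta>(2) global[OF pos(2)] pos in \<open>auto intro: less_imp_le\<close>)
      then show ?thesis using False \<beta>(1) by blast
    qed
  qed auto
  then have "\<exists>\<beta>. \<forall>\<epsilon> n r. \<epsilon> > 0 \<longrightarrow> r > 0 \<longrightarrow> \<beta> \<epsilon> n r \<noteq> - e \<and>
      estimate_on (J (\<beta> \<epsilon> n r)) (D r) (partial_sum a n r) (x r) \<epsilon> \<and>
      (r < min (rbar n) (root (n + 1) (\<epsilon> / C n)) \<longrightarrow> \<beta> \<epsilon> n r = e)"
    by (intro choice allI)
  then obtain \<beta> :: "real \<Rightarrow> nat \<Rightarrow> real \<Rightarrow> ereal" where \<beta>: "\<forall>\<epsilon>>0. \<forall>n. \<forall>r>0. \<beta> \<epsilon> n r \<noteq> - e \<and>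
      estimate_on (J (\<beta> \<epsilon> n r)) (D r) (partial_sum a n r) (x r) \<epsilon> \<and>
      (r < min (rbar n) (root (n + 1) (\<epsilon> / C n)) \<longrightarrow> \<beta> \<epsilon> n r = e)"
    by blast
  show ?thesis
  proof (rule exI[of _ a], rule exI[of _ C], rule exI[of _ rbar], intro conjI)
    show "\<forall>n. continuous_on UNIV (a n) \<and> bounded (range (a n))"
      using Ck_bounded_continuous[OF coeff_smooth[of 0]] Ck_bounded_imp_bounded[OF coeff_smooth[of 0]] by blast
    show "\<forall>n. C n > 0 \<and> rbar n > 0" using C rbar by blast
    show "\<forall>n r. 0 < r \<and> r < rbar n \<longrightarrow>
      estimate_on UNIV (D r) (partial_sum a n r) (x r) (C n * r ^ (n + 1))" using est by blast
  qed (rule slow_coeff.simps(1) asym formal_coefficients_coeff exI[of _ \<beta>] \<beta>)+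
qed

text \<open>
  A finite end of the domain would contradict the maximality of the pullback solution, because the
  continuation beyond it has the same limit at \<open>-\<infinity>\<close>.
\<close>
lemma pullback_minus_series:
  assumes f_bounded: "bounded (range (\<lambda>(x, l). f x l))"
    and stable: "\<And>\<tau>. d_x f (x\<^sub>0 \<tau>) (\<Lambda> \<tau>) < 0"
    and lims: "(\<Lambda> \<longlongrightarrow> l) at_bot" "(x\<^sub>0 \<longlongrightarrow> z) at_bot" and nz: "d_x f z l \<noteq> 0"
    and pullback: "\<And>r. r > 0 \<Longrightarrow> pullback_minus f \<Lambda> r z (b r) (x r)"
  shows "\<exists>(a :: nat \<Rightarrow> real \<Rightarrow> real) (C :: nat \<Rightarrow> real) (rbar :: nat \<Rightarrow> real).
        (\<forall>n. continuous_on UNIV (a n) \<and> bounded (range (a n))) \<and>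
        a 0 = x\<^sub>0 \<and>
        (\<forall>n. C n > 0 \<and> rbar n > 0) \<and>
        (\<forall>n r. 0 < r \<and> r < rbar n \<longrightarrow>
           estimate_on UNIV {t. ereal t < b r} (partial_sum a n r) (x r) (C n * r ^ (n + 1))) \<and>
        asymptotic_series (\<lambda>r. {t. ereal t < b r}) x a \<and>
        formal_coefficients f \<Lambda> a \<and>
        (\<exists>\<beta> :: real \<Rightarrow> nat \<Rightarrow> real \<Rightarrow> ereal. \<forall>\<epsilon>>0. \<forall>n. \<forall>r>0.
           \<beta> \<epsilon> n r \<noteq> -\<infinity> \<and>
           estimate_on {t. ereal t < \<beta> \<epsilon> n r} {t. ereal t < b r} (partial_sum a n r) (x r) \<epsilon> \<and>
           (r < min (rbar n) (root (n + 1) (\<epsilon> / C n)) \<longrightarrow> \<beta> \<epsilon> n r = \<infinity>))"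
proof -
  have sol: "DERIV (x r) t :> f (x r t) (\<Lambda> (r * t))" if "r > 0" "ereal t < b r" for r t
    using pullback[OF that(1)] that(2) by (simp add: pullback_minus_def solution_on_def)
  have x_lim: "(x r \<longlongrightarrow> z) at_bot" if "r > 0" for r
    using pullback[OF that] by (simp add: pullback_minus_def)
  have global: "b r = \<infinity>" if r: "r > 0" for r
  proof (cases "b r")
    case (real T)
    have D: "DERIV (x r) t :> 1 * f (x r t) (\<Lambda> (r * (1 * t)))" if "t < T" for t
      using sol[OF r, of t] that real by simp
    obtain y T' where y: "T < T'" "\<And>t. t < T' \<Longrightarrow> DERIV y t :> 1 * f (y t) (\<Lambda> (r * (1 * t)))"
      "eventually (\<lambda>t. y t = x r t) at_bot"
      using solution_continues[where T=T and \<sigma>=1, OF f_bounded abs_one D] by blast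
    have "(y \<longlongrightarrow> z) at_bot" using tendsto_cong[OF y(3)] x_lim[OF r] by simp
    moreover have "solution_on f \<Lambda> r {t. ereal t < ereal T'} y"
      using y(2) by (simp add: solution_on_def)
    moreover have "ereal T' \<noteq> - \<infinity>" by simp
    ultimately have "ereal T' \<le> b r"
      using pullback[OF r] unfolding pullback_minus_def by blast
    then show ?thesis using real y(1) by simp
  qed (use pullback[OF r] in \<open>auto simp: pullback_minus_def\<close>)
  have scale: "filterlim (\<lambda>t. r * t) at_bot (at_bot :: real filter)" if "r > 0" for r :: real
    using filterlim_tendsto_pos_mult_at_bot[OF tendsto_const[of r] that filterlim_ident] .
  have diff_lim: "((\<lambda>t. partial_sum a n r t - x r t) \<longlongrightarrow> 0) at_bot" if r: "r > 0" for n r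
    using tendsto_diff[OF truncation_tendsto_slow[OF lims filterlim_shift_at_bot nz scale[OF r]] x_lim[OF r]]
    by simp
  have tracking: "\<exists>C>0. \<exists>rbar>0. \<forall>r t. 0 < r \<longrightarrow> r < rbar \<longrightarrow>
      \<bar>partial_sum a n r t - x r t\<bar> \<le> C * r ^ (n + 1)" for n
  proof -
    have "1 * d_x f (x\<^sub>0 \<tau>) (\<Lambda> \<tau>) < 0" for \<tau> using stable by simp
    then obtain C rbar where C: "C > 0" "rbar > 0"
      and track: "\<And>r z b t. 0 < r \<Longrightarrow> r < rbar \<Longrightarrow>
       (\<And>t. ereal t < b \<Longrightarrow> DERIV z t :> 1 * f (z t) (\<Lambda> (r * (1 * t)))) \<Longrightarrow>
       ((\<lambda>t. z t - (\<Sum>i\<le>n. a i (r * (1 * t)) * r ^ i)) \<longlongrightarrow> 0) at_bot \<Longrightarrow>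
       ereal t < b \<Longrightarrow> \<bar>z t - (\<Sum>i\<le>n. a i (r * (1 * t)) * r ^ i)\<bar> < C * r ^ (n + 1)"
      using solution_tracks_truncation[of 1 n, OF abs_one] by blast
    have "\<bar>partial_sum a n r t - x r t\<bar> \<le> C * r ^ (n + 1)" if r: "0 < r" "r < rbar" for r t
    proof -
      have "\<bar>x r t - (\<Sum>i\<le>n. a i (r * (1 * t)) * r ^ i)\<bar> < C * r ^ (n + 1)"
      proof (rule track[OF r, where b=\<infinity>])
        show "DERIV (x r) t :> 1 * f (x r t) (\<Lambda> (r * (1 * t)))" for t
          using sol[OF r(1)] global[OF r(1)] by simp
        show "((\<lambda>t. x r t - (\<Sum>i\<le>n. a i (r * (1 * t)) * r ^ i)) \<longlongrightarrow> 0) at_bot"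
          using tendsto_minus[OF diff_lim[OF r(1), of n]] by (simp add: partial_sum_def)
      qed simp
      then show ?thesis by (simp add: partial_sum_def abs_minus_commute)
    qed
    then show ?thesis using C by blast
  qed
  have "\<exists>\<beta>. \<beta> \<noteq> - \<infinity> \<and> (\<forall>t\<in>{t. ereal t < \<beta>}. P t)" if "eventually P at_bot" for P
  proof -
    obtain N where "\<forall>t\<le>N. P t" using \<open>eventually P at_bot\<close> unfolding eventually_at_bot_linorder by blast
    then show ?thesis by (intro exI[of _ "ereal N"]) auto
  qed
  then show ?thesis
    by (intro series_of_tracking[where J="\<lambda>\<beta>. {t. ereal t < \<beta>}" and Fl=at_bot] tracking diff_lim)
      (auto simp: global)
qed

text \<open>
  The mirror image of the previous lemma: \<open>t \<mapsto> x r (- t)\<close> solves the equation run backwards in time, for which the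
  unstable curve is attracting.
\<close>
lemma pullback_plus_series:
  assumes f_bounded: "bounded (range (\<lambda>(x, l). f x l))"
    and unstable: "\<And>\<tau>. d_x f (x\<^sub>0 \<tau>) (\<Lambda> \<tau>) > 0"
    and lims: "(\<Lambda> \<longlongrightarrow> l) at_top" "(x\<^sub>0 \<longlongrightarrow> z) at_top" and nz: "d_x f z l \<noteq> 0"
    and pullback: "\<And>r. r > 0 \<Longrightarrow> pullback_plus f \<Lambda> r z (b r) (x r)"
  shows "\<exists>(a :: nat \<Rightarrow> real \<Rightarrow> real) (C :: nat \<Rightarrow> real) (rbar :: nat \<Rightarrow> real).
        (\<forall>n. continuous_on UNIV (a n) \<and> bounded (range (a n))) \<and>
        a 0 = x\<^sub>0 \<and>
        (\<forall>n. C n > 0 \<and> rbar n > 0) \<and>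
        (\<forall>n r. 0 < r \<and> r < rbar n \<longrightarrow>
           estimate_on UNIV {t. b r < ereal t} (partial_sum a n r) (x r) (C n * r ^ (n + 1))) \<and>
        asymptotic_series (\<lambda>r. {t. b r < ereal t}) x a \<and>
        formal_coefficients f \<Lambda> a \<and>
        (\<exists>\<alpha> :: real \<Rightarrow> nat \<Rightarrow> real \<Rightarrow> ereal. \<forall>\<epsilon>>0. \<forall>n. \<forall>r>0.
           \<alpha> \<epsilon> n r \<noteq> \<infinity> \<and>
           estimate_on {t. \<alpha> \<epsilon> n r < ereal t} {t. b r < ereal t} (partial_sum a n r) (x r) \<epsilon> \<and>
           (r < min (rbar n) (root (n + 1) (\<epsilon> / C n)) \<longrightarrow> \<alpha> \<epsilon> n r = -\<infinity>))"
proof -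
  have sol: "DERIV (\<lambda>t. x r (- t)) t :> - 1 * f (x r (- t)) (\<Lambda> (r * (- 1 * t)))"
    if "r > 0" "b r < ereal (- t)" for r t
  proof -
    have "DERIV (x r) (- t) :> f (x r (- t)) (\<Lambda> (r * - t))"
      using pullback[OF that(1)] that(2) unfolding pullback_plus_def solution_on_def by blast
    then show ?thesis by (simp add: DERIV_mirror)
  qed
  have x_lim: "(x r \<longlongrightarrow> z) at_top" if "r > 0" for r
    using pullback[OF that] by (simp add: pullback_plus_def)
  have global: "b r = - \<infinity>" if r: "r > 0" for r
  proof (cases "b r")
    case (real T)
    have D: "DERIV (\<lambda>t. x r (- t)) t :> - 1 * f (x r (- t)) (\<Lambda> (r * (- 1 * t)))" if "t < - T" for t
      using that real by (intro sol[OF r]) simp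
    have "\<bar>- 1\<bar> = (1 :: real)" by simp
    then obtain y T' where y: "- T < T'" "\<And>t. t < T' \<Longrightarrow> DERIV y t :> - 1 * f (y t) (\<Lambda> (r * (- 1 * t)))"
      "eventually (\<lambda>t. y t = x r (- t)) at_bot"
      using solution_continues[where T="- T" and \<sigma>="- 1", OF f_bounded _ D] by blast
    have "((\<lambda>t. x r (- t)) \<longlongrightarrow> z) at_bot"
      using x_lim[OF r] by (simp add: filterlim_at_top_mirror)
    then have "(y \<longlongrightarrow> z) at_bot" using tendsto_cong[OF y(3)] by simp
    then have "((\<lambda>t. y (- t)) \<longlongrightarrow> z) at_top"
      by (simp add: filterlim_at_top_mirror)
    moreover have "solution_on f \<Lambda> r {t. ereal (- T') < ereal t} (\<lambda>t. y (- t))"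
      unfolding solution_on_def
    proof
      fix t assume "t \<in> {t. ereal (- T') < ereal t}"
      then have "DERIV y (- t) :> - f (y (- t)) (\<Lambda> (r * t))" using y(2)[of "- t"] by simp
      then show "DERIV (\<lambda>t. y (- t)) t :> f (y (- t)) (\<Lambda> (r * t))" by (simp add: DERIV_mirror)
    qed
    moreover have "ereal (- T') \<noteq> \<infinity>" by simp
    ultimately have "b r \<le> ereal (- T')"
      using pullback[OF r] unfolding pullback_plus_def by blast
    then show ?thesis using real y(1) by simp
  qed (use pullback[OF r] in \<open>auto simp: pullback_plus_def\<close>)
  have scale: "filterlim (\<lambda>t. r * t) at_top (at_top :: real filter)" if "r > 0" for r :: real
    using filterlim_tendsto_pos_mult_at_top[OF tendsto_const[of r] that filterlim_ident] .
  have diff_lim: "((\<lambda>t. partial_sum a n r t - x r t) \<longlongrightarrow> 0) at_top" if r: "r > 0" for n r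
    using tendsto_diff[OF truncation_tendsto_slow[OF lims filterlim_shift_at_top nz scale[OF r]] x_lim[OF r]]
    by simp
  have tracking: "\<exists>C>0. \<exists>rbar>0. \<forall>r t. 0 < r \<longrightarrow> r < rbar \<longrightarrow>
      \<bar>partial_sum a n r t - x r t\<bar> \<le> C * r ^ (n + 1)" for n
  proof -
    have "- 1 * d_x f (x\<^sub>0 \<tau>) (\<Lambda> \<tau>) < 0" for \<tau> using unstable[of \<tau>] by simp
    moreover have "\<bar>- 1\<bar> = (1 :: real)" by simp
    ultimately obtain C rbar where C: "C > 0" "rbar > 0"
      and track: "\<And>r z b t. 0 < r \<Longrightarrow> r < rbar \<Longrightarrow>
       (\<And>t. ereal t < b \<Longrightarrow> DERIV z t :> - 1 * f (z t) (\<Lambda> (r * (- 1 * t)))) \<Longrightarrow>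
       ((\<lambda>t. z t - (\<Sum>i\<le>n. a i (r * (- 1 * t)) * r ^ i)) \<longlongrightarrow> 0) at_bot \<Longrightarrow>
       ereal t < b \<Longrightarrow> \<bar>z t - (\<Sum>i\<le>n. a i (r * (- 1 * t)) * r ^ i)\<bar> < C * r ^ (n + 1)"
      using solution_tracks_truncation[of "- 1" n] by blast
    have "\<bar>partial_sum a n r t - x r t\<bar> \<le> C * r ^ (n + 1)" if r: "0 < r" "r < rbar" for r t
    proof -
      have "\<bar>x r (- (- t)) - (\<Sum>i\<le>n. a i (r * (- 1 * - t)) * r ^ i)\<bar> < C * r ^ (n + 1)"
      proof (rule track[OF r, where b=\<infinity>])
        show "DERIV (\<lambda>t. x r (- t)) t :> - 1 * f (x r (- t)) (\<Lambda> (r * (- 1 * t)))" for t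
          by (rule sol[OF r(1)]) (simp add: global[OF r(1)])
        have "((\<lambda>t. partial_sum a n r (- t) - x r (- t)) \<longlongrightarrow> 0) at_bot"
          using diff_lim[OF r(1), of n] by (simp add: filterlim_at_top_mirror)
        from tendsto_minus[OF this]
        show "((\<lambda>t. x r (- t) - (\<Sum>i\<le>n. a i (r * (- 1 * t)) * r ^ i)) \<longlongrightarrow> 0) at_bot"
          by (simp add: partial_sum_def)
      qed simp
      then show ?thesis by (simp add: partial_sum_def abs_minus_commute)
    qed
    then show ?thesis using C by blast
  qed
  have "\<exists>\<beta>. \<beta> \<noteq> \<infinity> \<and> (\<forall>t\<in>{t. \<beta> < ereal t}. P t)" if "eventually P at_top" for P
  proof -
    obtain N where "\<forall>t\<ge>N. P t" using \<open>eventually P at_top\<close> unfolding eventually_at_top_linorder by blast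
    then show ?thesis by (intro exI[of _ "ereal N"]) auto
  qed
  then have J: "\<exists>\<beta>. \<beta> \<noteq> - (- \<infinity>) \<and> (\<forall>t\<in>{t. \<beta> < ereal t}. P t)" if "eventually P at_top" for P
    using that by simp
  show ?thesis
    using series_of_tracking[where J="\<lambda>\<beta>. {t. \<beta> < ereal t}" and Fl=at_top and e="- \<infinity>" and x=x
        and D="\<lambda>r. {t. b r < ereal t}", OF tracking _ diff_lim _ J]
    by (simp add: global)
qed

end

text \<open>
  Used for the unstable curve: hyperbolicity along the curve and instability at its end give instability everywhere.
\<close>
lemma nonzero_keeps_sign:
  fixes h :: "real \<Rightarrow> real"
  assumes "continuous_on {lm..lp} h" "\<And>l. l \<in> {lm..lp} \<Longrightarrow> h l \<noteq> 0" "h lp > 0" "l \<in> {lm..lp}"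
  shows "h l > 0"
proof (rule ccontr)
  assume "\<not> h l > 0"
  then have "\<exists>u. l \<le> u \<and> u \<le> lp \<and> h u = 0"
    using assms by (intro IVT') (auto intro: continuous_on_subset)
  then show False using assms by force
qed

lemma composite_tendsto:
  fixes X \<Lambda> :: "real \<Rightarrow> real"
  assumes "continuous_on S X" "range \<Lambda> \<subseteq> S" "(\<Lambda> \<longlongrightarrow> l) Fl" "l \<in> S"
  shows "((\<lambda>\<tau>. X (\<Lambda> \<tau>)) \<longlongrightarrow> X l) Fl"
  by (rule continuous_on_tendsto_compose[OF assms(1,3,4)]) (use assms(2) in \<open>auto intro!: always_eventually\<close>)

theorem proposition4p2:
  fixes f :: "real \<Rightarrow> real \<Rightarrow> real" and \<Lambda> Xs Xu :: "real \<Rightarrow> real" and lm lp p :: real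
    and bm bp :: "real \<Rightarrow> ereal" and xm xp :: "real \<Rightarrow> real \<Rightarrow> real"
  assumes "H0 f \<Lambda> lm lp Xs p"
    and "x_partials_continuous f"
    and "x_partials_bounded_along f \<Lambda> Xs"
    and "derivatives_of_all_orders f \<Lambda>"
    and "\<forall>r>0. pullback_minus f \<Lambda> r (Xs lm) (bm r) (xm r)"
  shows
    "(\<exists>(a :: nat \<Rightarrow> real \<Rightarrow> real) (C :: nat \<Rightarrow> real) (rbar :: nat \<Rightarrow> real).
        (\<forall>n. continuous_on UNIV (a n) \<and> bounded (range (a n))) \<and>
        a 0 = (\<lambda>\<tau>. Xs (\<Lambda> \<tau>)) \<and>
        (\<forall>n. C n > 0 \<and> rbar n > 0) \<and>
        (\<forall>n r. 0 < r \<and> r < rbar n \<longrightarrow>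
           estimate_on UNIV {t. ereal t < bm r} (partial_sum a n r) (xm r) (C n * r ^ (n + 1))) \<and>
        asymptotic_series (\<lambda>r. {t. ereal t < bm r}) xm a \<and>
        formal_coefficients f \<Lambda> a \<and>
        (\<exists>\<beta> :: real \<Rightarrow> nat \<Rightarrow> real \<Rightarrow> ereal. \<forall>\<epsilon>>0. \<forall>n. \<forall>r>0.
           \<beta> \<epsilon> n r \<noteq> -\<infinity> \<and>
           estimate_on {t. ereal t < \<beta> \<epsilon> n r} {t. ereal t < bm r} (partial_sum a n r) (xm r) \<epsilon> \<and>
           (r < min (rbar n) (root (n + 1) (\<epsilon> / C n)) \<longrightarrow> \<beta> \<epsilon> n r = \<infinity>)))
     \<and>
     (H1 f lm lp Xs Xu \<and> x_partials_bounded_along f \<Lambda> Xu \<and>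
      (\<forall>r>0. pullback_plus f \<Lambda> r (Xu lp) (bp r) (xp r)) \<longrightarrow>
      (\<exists>(a :: nat \<Rightarrow> real \<Rightarrow> real) (C :: nat \<Rightarrow> real) (rbar :: nat \<Rightarrow> real).
        (\<forall>n. continuous_on UNIV (a n) \<and> bounded (range (a n))) \<and>
        a 0 = (\<lambda>\<tau>. Xu (\<Lambda> \<tau>)) \<and>
        (\<forall>n. C n > 0 \<and> rbar n > 0) \<and>
        (\<forall>n r. 0 < r \<and> r < rbar n \<longrightarrow>
           estimate_on UNIV {t. bp r < ereal t} (partial_sum a n r) (xp r) (C n * r ^ (n + 1))) \<and>
        asymptotic_series (\<lambda>r. {t. bp r < ereal t}) xp a \<and>
        formal_coefficients f \<Lambda> a \<and>
        (\<exists>\<alpha> :: real \<Rightarrow> nat \<Rightarrow> real \<Rightarrow> ereal. \<forall>\<epsilon>>0. \<forall>n. \<forall>r>0.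
           \<alpha> \<epsilon> n r \<noteq> \<infinity> \<and>
           estimate_on {t. \<alpha> \<epsilon> n r < ereal t} {t. bp r < ereal t} (partial_sum a n r) (xp r) \<epsilon> \<and>
           (r < min (rbar n) (root (n + 1) (\<epsilon> / C n)) \<longrightarrow> \<alpha> \<epsilon> n r = -\<infinity>))))"
proof -
  have f: "Ck_plane k f" and \<Lambda>: "Ck_bounded k \<Lambda>" for k
    using assms(4) by (auto simp: derivatives_of_all_orders_def intro: Ck_bounded_of_bounded_derivatives)
  have f_bounded: "bounded (range (\<lambda>(x, l). f x l))" and range: "range \<Lambda> \<subseteq> {lm..lp}"
    and ends: "lm \<in> {lm..lp}" "lp \<in> {lm..lp}"
    and lims: "(\<Lambda> \<longlongrightarrow> lm) at_bot" "(\<Lambda> \<longlongrightarrow> lp) at_top"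
    and Xs: "continuous_on {lm..lp} Xs" "\<And>l. l \<in> {lm..lp} \<Longrightarrow> f (Xs l) l = 0"
      "\<And>l. l \<in> {lm..lp} \<Longrightarrow> d_x f (Xs l) l < 0"
    using assms(1) by (auto simp: H0_def stable_hyperbolic_def)
  have \<Lambda>_mem: "\<Lambda> \<tau> \<in> {lm..lp}" for \<tau> using range by blast
  obtain m where "slow_curve f \<Lambda> (\<lambda>\<tau>. Xs (\<Lambda> \<tau>)) m"
    using slow_curve_of_equilibria[OF f \<Lambda> range Xs(1,2)] Xs(3) by (metis less_irrefl)
  then interpret s: slow_curve f \<Lambda> "\<lambda>\<tau>. Xs (\<Lambda> \<tau>)" m .
  note minus = s.pullback_minus_series[OF f_bounded Xs(3)[OF \<Lambda>_mem] lims(1)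
      composite_tendsto[OF Xs(1) range lims(1) ends(1)], of bm xm]
  have plus: "(\<exists>(a :: nat \<Rightarrow> real \<Rightarrow> real) (C :: nat \<Rightarrow> real) (rbar :: nat \<Rightarrow> real).
        (\<forall>n. continuous_on UNIV (a n) \<and> bounded (range (a n))) \<and>
        a 0 = (\<lambda>\<tau>. Xu (\<Lambda> \<tau>)) \<and>
        (\<forall>n. C n > 0 \<and> rbar n > 0) \<and>
        (\<forall>n r. 0 < r \<and> r < rbar n \<longrightarrow>
           estimate_on UNIV {t. bp r < ereal t} (partial_sum a n r) (xp r) (C n * r ^ (n + 1))) \<and>
        asymptotic_series (\<lambda>r. {t. bp r < ereal t}) xp a \<and>
        formal_coefficients f \<Lambda> a \<and>
        (\<exists>\<alpha> :: real \<Rightarrow> nat \<Rightarrow> real \<Rightarrow> ereal. \<forall>\<epsilon>>0. \<forall>n. \<forall>r>0.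
           \<alpha> \<epsilon> n r \<noteq> \<infinity> \<and>
           estimate_on {t. \<alpha> \<epsilon> n r < ereal t} {t. bp r < ereal t} (partial_sum a n r) (xp r) \<epsilon> \<and>
           (r < min (rbar n) (root (n + 1) (\<epsilon> / C n)) \<longrightarrow> \<alpha> \<epsilon> n r = -\<infinity>)))" if "H1 f lm lp Xs Xu" and pb: "\<forall>r>0. pullback_plus f \<Lambda> r (Xu lp) (bp r) (xp r)"
  proof -
    have Xu: "continuous_on {lm..lp} Xu" "\<And>l. l \<in> {lm..lp} \<Longrightarrow> f (Xu l) l = 0"
      "\<And>l. l \<in> {lm..lp} \<Longrightarrow> d_x f (Xu l) l \<noteq> 0" and end_pos: "d_x f (Xu lp) lp > 0"
      using that(1) by (auto simp: H1_def hyperbolic_def unstable_hyperbolic_def)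
    have "Ck_plane (Suc 0) (d_x f)" using f[of "Suc (Suc 0)"] by simp
    then have "continuous_on {lm..lp} (\<lambda>l. d_x f (Xu l) l)"
      using continuous_on_compose2[OF Ck_plane_1_continuous continuous_on_Pair[OF Xu(1) continuous_on_id]]
      by simp
    then have pos: "d_x f (Xu l) l > 0" if "l \<in> {lm..lp}" for l
      using nonzero_keeps_sign[of lm lp "\<lambda>l. d_x f (Xu l) l"] Xu(3) end_pos that by blast
    obtain m where "slow_curve f \<Lambda> (\<lambda>\<tau>. Xu (\<Lambda> \<tau>)) m"
      using slow_curve_of_equilibria[OF f \<Lambda> range Xu] by blast
    then interpret u: slow_curve f \<Lambda> "\<lambda>\<tau>. Xu (\<Lambda> \<tau>)" m .
    show ?thesis
      using u.pullback_plus_series[OF f_bounded pos[OF \<Lambda>_mem] lims(2)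
        composite_tendsto[OF Xu(1) range lims(2) ends(2)] Xu(3)[OF ends(2)], of bp xp] pb by blast
  qed
  have "d_x f (Xs lm) lm \<noteq> 0" using Xs(3)[OF ends(1)] by simp
  from minus[OF this] assms(5) plus show ?thesis by blast
qed

end
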